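(* Let $K$ be an imaginary quadratic field with ring of integers $\mathcal{O}_K$. The Schmidt arrangement $\mathcal{S}_K$, viewed as a subset of $\widehat{\mathbb{C}}$, is connected if and only if $\mathcal{O}_K$ is a Euclidean domain. If $\mathcal{S}_K$ is disconnected, it has infinitely many connected components.
   Context: $\mathrm{PSL}_2(\mathcal{O}_K)$ acts on $\widehat{\mathbb{C}}=\mathbb{C}\cup\{\infty\}$ by Möbius transformations $\begin{pmatrix}\alpha&\gamma\\ \beta&\delta\end{pmatrix}: z\mapsto(\alpha z+\gamma)/(\beta z+\delta)$. The Schmidt arrangement $\mathcal{S}_K$ is the orbit of the extended real line $\widehat{\mathbb{R}}=\mathbb{R}\cup\{\infty\}$ under $\mathrm{PSL}_2(\mathcal{O}_K)$, regarded as the union in $\widehat{\mathbb{C}}$ of all the circles $M(\widehat{\mathbb{R}})$, $M\in\mathrm{PSL}_2(\mathcal{O}_K)$, with the subspace topology. *)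

theory Defs
  imports
    "HOL-Analysis.Analysis"
    "HOL-Computational_Algebra.Polynomial"
    "HOL-Algebra.Embedded_Algebras"
    "HOL-Algebra.Ring_Divisibility"
    "HOL-Algebra.Algebraic_Closure_Type"
begin

section \<open>Imaginary quadratic fields and their rings of integers\<close>

text \<open>
  An imaginary quadratic field is taken as a subfield of the complex numbers; both of its
  complex embeddings have the same image, so no choice is involved.
\<close>

abbreviation complex_ring :: "complex ring" where
  "complex_ring \<equiv> ring_of_type_algebra"

definition imaginary_quadratic_field :: "complex set \<Rightarrow> bool" where
  "imaginary_quadratic_field K \<longleftrightarrow>
     subfield K complex_ring \<and> ring.dimension complex_ring 2 \<rat> K \<and> \<not> K \<subseteq> \<real>"

definition ring_of_integers :: "complex set \<Rightarrow> complex set" where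
  "ring_of_integers K = {x \<in> K. algebraic_int x}"

definition is_euclidean_domain :: "complex set \<Rightarrow> bool" where
  "is_euclidean_domain R \<longleftrightarrow> (\<exists>\<phi>. euclidean_domain (complex_ring\<lparr>carrier := R\<rparr>) \<phi>)"


section \<open>The extended complex plane and Moebius transformations\<close>

text \<open>The point at infinity is \<open>None\<close>; a complex number \<open>z\<close> is \<open>Some z\<close>.\<close>

definition riemann_sphere :: "complex option topology" where
  "riemann_sphere = Alexandroff_compactification euclidean"

definition extended_reals :: "complex option set" where
  "extended_reals = insert None (Some ` \<real>)"

fun mobius :: "complex^2^2 \<Rightarrow> complex option \<Rightarrow> complex option" where
  "mobius A None = (if A$2$1 = 0 then None else Some (A$1$1 / A$2$1))"
| "mobius A (Some z) =
     (if A$2$1 * z + A$2$2 = 0 then None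
      else Some ((A$1$1 * z + A$1$2) / (A$2$1 * z + A$2$2)))"

definition SL2 :: "complex set \<Rightarrow> (complex^2^2) set" where
  "SL2 R = {A. (\<forall>i j. A$i$j \<in> R) \<and> det A = 1}"

definition SL2_sign_rel :: "complex set \<Rightarrow> ((complex^2^2) \<times> (complex^2^2)) set" where
  "SL2_sign_rel R = {(A, B). A \<in> SL2 R \<and> B \<in> SL2 R \<and> (B = A \<or> B = - A)}"

definition PSL2 :: "complex set \<Rightarrow> (complex^2^2) set set" where
  "PSL2 R = SL2 R // SL2_sign_rel R"

text \<open>
  An element \<open>M\<close> of \<open>PSL2 R\<close> is a class of matrices, all inducing the same transformation
  (lemma \<open>PSL2_act_class\<close>); \<open>the_elem\<close> extracts the common value.
\<close>

definition PSL2_act :: "(complex^2^2) set \<Rightarrow> complex option \<Rightarrow> complex option" where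
  "PSL2_act M z = the_elem ((\<lambda>A. mobius A z) ` M)"

lemma equiv_SL2_sign_rel: "equiv (SL2 R) (SL2_sign_rel R)"
  by (rule equivI) (auto simp: SL2_sign_rel_def refl_on_def sym_def trans_def)

lemma mobius_uminus: "mobius (- A) z = mobius A z"
proof (cases z)
  case (Some w)
  have d: "- (A$2$1 * w) - A$2$2 = - (A$2$1 * w + A$2$2)"
    and n: "- (A$1$1 * w) - A$1$2 = - (A$1$1 * w + A$1$2)"
    by simp_all
  show ?thesis
    by (simp add: Some d n del: minus_add_distrib)
qed simp

lemma PSL2_act_class:
  assumes "A \<in> SL2 R"
  shows "PSL2_act (SL2_sign_rel R `` {A}) z = mobius A z"
proof -
  have "(\<lambda>B. mobius B z) ` (SL2_sign_rel R `` {A}) = {mobius A z}"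
    using assms by (auto simp: SL2_sign_rel_def mobius_uminus)
  then show ?thesis by (simp add: PSL2_act_def)
qed


section \<open>The Schmidt arrangement\<close>

definition schmidt_circles :: "complex set \<Rightarrow> complex option set set" where
  "schmidt_circles K = (\<lambda>M. PSL2_act M ` extended_reals) ` PSL2 (ring_of_integers K)"

definition schmidt_arrangement :: "complex set \<Rightarrow> complex option set" where
  "schmidt_arrangement K = \<Union> (schmidt_circles K)"

end

theory Submission
  imports Defs "HOL-Computational_Algebra.Squarefree"
begin

text \<open>
  Let \<open>-D\<close> be the discriminant of \<open>K\<close>. Any complex number is at distance less than \<open>1\<close> from the ring
  of integers iff \<open>D < 12\<close>. If so, Euclidean division writes a matrix of \<open>SL\<^sub>2\<close> as a product of
  matrices \<open>z \<mapsto> q - 1 / z\<close> and an affine map, and since these move the real line to circles meeting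
  it, every circle of the arrangement is joined to the real line by a chain of circles. Otherwise
  \<open>D \<ge> 15\<close>; Motzkin's argument shows that there is no Euclidean function at all, and Stange's ghost
  circle is disjoint from the arrangement, since by a congruence its inversive product with every
  circle of the arrangement exceeds \<open>1\<close> in absolute value. The orbit of \<open>\<infinity>\<close> enters the ghost
  disc, so the integer translates of the disc cut off infinitely many components.
\<close>

text \<open>Both halves turn on the covering radius R of the lattice of integers. If R < 1, division
  works. If R > 1, a point farthest from the lattice serves as centre of the ghost circle;
  orthogonality to the unit circles around the nearest lattice points makes its squared radius R^2 -
  1, so the circle is real precisely when R > 1. The borderline R = 1 is \<open>D = 12\<close>,
  which no maximal order attains. Disjointness comes from conjugation: it moves an element of the
  order by an integer multiple of sqrt(-D), so the linear coefficient of every circle of the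
  arrangement is 1 modulo sqrt(-D). The scaled inversive product then runs through an arithmetic
  progression that stays away from 0. A component inside the disc still needs a point of the
  arrangement there. K is dense in the plane, but when the class number exceeds 1 not every element
  of K lies in the orbit of infinity; hence an explicit sequence of orbit points.\<close>

no_notation fps_nth (infixl "$" 75)

section \<open>The ring of integers of an imaginary quadratic field\<close>

text \<open>Contents are multiplicative, and both \<open>m\<close> and the monic \<open>p\<close>
  have content 1, so \<open>c\<close> agrees up to sign with the content of the cofactor and
  cancels. The leading coefficient of \<open>m\<close> then divides 1.\<close>

lemma primitive_factor_of_monic:
  fixes m p :: "int poly"
  assumes "content m = 1" "Polynomial.lead_coeff p = 1" "c \<noteq> 0" "m dvd Polynomial.smult c p"
  shows "\<bar>Polynomial.lead_coeff m\<bar> = 1"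
proof -
  obtain q where q: "Polynomial.smult c p = m * q"
    using assms(4) by (elim dvdE)
  have "content p dvd 1"
    using content_dvd_coeff[of p "Polynomial.degree p"] assms(2) by simp
  then have "content p = 1"
    by (metis is_unit_normalize normalize_content)
  then have "\<bar>c\<bar> = content q"
    using arg_cong[OF q, of content] assms(1) by (simp add: content_mult)
  then have "c dvd content q"
    by (metis dvd_refl abs_dvd_iff)
  then have "[:c:] dvd q"
    by (simp add: const_poly_dvd_iff_dvd_content)
  then obtain q' where "q = [:c:] * q'"
    by (elim dvdE)
  then have "Polynomial.smult c p = Polynomial.smult c (m * q')"
    using q by simp
  then have "Polynomial.smult c (p - m * q') = 0"
    by (simp add: Polynomial.smult_diff_right)
  then have "p = m * q'"
    using assms(3) by simp
  then have "Polynomial.lead_coeff m * Polynomial.lead_coeff q' = 1"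
    using assms(2) by (simp add: lead_coeff_mult)
  then have "Polynomial.lead_coeff m dvd 1"
    by (metis dvd_triv_left)
  then show ?thesis by simp
qed

lemma poly_of_int_poly_add:
  "poly (map_poly of_int (p + q)) x = poly (map_poly of_int p) x + poly (map_poly of_int q) (x :: 'a :: comm_ring_1)"
proof -
  have "map_poly of_int (p + q) = map_poly of_int p + map_poly (of_int :: int \<Rightarrow> 'a) q"
    by (rule poly_eqI) (simp add: coeff_map_poly)
  then show ?thesis by simp
qed

lemma poly_of_int_poly_smult:
  "poly (map_poly of_int (Polynomial.smult c p)) x = of_int c * poly (map_poly of_int p) (x :: 'a :: comm_ring_1)"
proof -
  have "map_poly of_int (Polynomial.smult c p) = Polynomial.smult (of_int c) (map_poly (of_int :: int \<Rightarrow> 'a) p)"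
    by (rule poly_eqI) (simp add: coeff_map_poly)
  then show ?thesis by simp
qed

lemma poly_of_int_poly_mult:
  "poly (map_poly of_int (p * q)) x = poly (map_poly of_int p) x * poly (map_poly of_int q) (x :: 'a :: comm_ring_1)"
  by (induction p) (simp_all add: map_poly_pCons poly_of_int_poly_add poly_of_int_poly_smult algebra_simps)

lemma of_int_poly_linear_eq_0:
  fixes r :: "int poly" and x :: complex
  assumes "poly (map_poly of_int r) x = 0" "Polynomial.degree r < 2" "Im x \<noteq> 0"
  shows "r = 0"
proof -
  obtain a b where r: "r = [:a, b:]"
  proof
    show "r = [:poly.coeff r 0, poly.coeff r 1:]"
      using assms(2) by (auto simp: poly_eq_iff coeff_pCons coeff_eq_0 split: nat.split)
  qed
  have e: "of_int a + of_int b * x = 0"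
    using assms(1) by (simp add: r map_poly_pCons mult.commute)
  have "Im (of_int a + of_int b * x) = 0"
    by (simp add: e)
  then have "b = 0" using assms(3) by simp
  with e show ?thesis by (simp add: r)
qed

text \<open>Gauss's lemma: the minimal polynomial of an algebraic integer is integral.\<close>

lemma algebraic_int_quadratic:
  fixes x :: complex and t n :: rat
  assumes "algebraic_int x" "Im x \<noteq> 0" "2 * Re x = of_rat t" "(cmod x)\<^sup>2 = of_rat n"
  shows "t \<in> \<int>" "n \<in> \<int>"
proof -
  obtain p where p: "poly (map_poly of_int p) x = 0" "Polynomial.lead_coeff p = 1"
    using assms(1) algebraic_int_altdef_ipoly by blast
  obtain t1 t2 where t: "quotient_of t = (t1, t2)" by fastforce
  obtain n1 n2 where n: "quotient_of n = (n1, n2)" by fastforce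
  have t': "t = of_int t1 / of_int t2" "t2 > 0"
    using t quotient_of_div quotient_of_denom_pos by blast+
  have n': "n = of_int n1 / of_int n2" "n2 > 0"
    using n quotient_of_div quotient_of_denom_pos by blast+
  \<comment> \<open>This is X^2 - t X + n, whose roots are \<open>x\<close> and its conjugate, with
    denominators cleared. Integrality follows once its content is shown to be the full factor
    \<open>t2 * n2\<close>.\<close>
  define m0 where "m0 = [:n1 * t2, - (t1 * n2), t2 * n2:]"
  have [simp]: "m0 \<noteq> 0" using t'(2) n'(2) by (simp add: m0_def)
  define m where "m = primitive_part m0"
  define c where "c = content m0"
  have m0: "m0 = Polynomial.smult c m"
    by (simp add: m_def c_def)
  have c: "c \<noteq> 0" by (simp add: c_def)
  have deg: "Polynomial.degree m = 2"
    using t'(2) n'(2) by (simp add: m_def m0_def)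
  have x2: "x\<^sup>2 = of_real (2 * Re x) * x - of_real ((cmod x)\<^sup>2)"
    unfolding cmod_power2 by (simp add: complex_eq_iff power2_eq_square algebra_simps)
  have "poly (map_poly of_int m0) x = of_int (n1 * t2) - of_int (t1 * n2) * x + of_int (t2 * n2) * x\<^sup>2"
    by (simp add: m0_def map_poly_pCons power2_eq_square algebra_simps)
  also have "\<dots> = 0"
    unfolding x2 assms(3,4) t'(1) n'(1) using t'(2) n'(2)
    by (simp add: of_rat_divide field_simps)
  finally have root: "poly (map_poly of_int m) x = 0"
    using c by (simp add: m0 poly_of_int_poly_smult)
  \<comment> \<open>Pseudo-division, because \<open>m\<close> is not yet known to have leading
    coefficient 1 or -1. The remainder has degree below 2 and the non-real root \<open>x\<close>, so
    it vanishes.\<close>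
  obtain q r where qr: "pseudo_divmod p m = (q, r)" by fastforce
  have mn: "m \<noteq> 0" using deg by auto
  define k where "k = Polynomial.lead_coeff m ^ (Suc (Polynomial.degree p) - Polynomial.degree m)"
  have eq: "Polynomial.smult k p = m * q + r"
    using pseudo_divmod(1)[OF mn qr] by (simp add: k_def)
  have "poly (map_poly of_int (Polynomial.smult k p)) x = poly (map_poly of_int (m * q + r)) x"
    by (simp only: eq)
  then have "poly (map_poly of_int r) x = 0"
    using p(1) root
    by (simp add: poly_of_int_poly_add poly_of_int_poly_smult poly_of_int_poly_mult)
  then have "r = 0"
    using of_int_poly_linear_eq_0[OF _ _ assms(2)] pseudo_divmod(2)[OF mn qr] deg by auto
  then have "m dvd Polynomial.smult k p" using eq by simp
  then have lc: "\<bar>Polynomial.lead_coeff m\<bar> = 1"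
  proof (intro primitive_factor_of_monic)
    show "content m = 1" by (simp add: m_def)
    show "k \<noteq> 0" using mn by (simp add: k_def)
  qed (use p(2) in auto)
  have coeffs: "c * poly.coeff m i = poly.coeff m0 i" for i
    by (simp add: m0)
  have cm: "\<bar>c\<bar> = t2 * n2"
  proof -
    have "c * Polynomial.lead_coeff m = t2 * n2"
      using coeffs[of 2] deg by (simp add: m0_def numeral_2_eq_2)
    then have "\<bar>c\<bar> * \<bar>Polynomial.lead_coeff m\<bar> = \<bar>t2 * n2\<bar>"
      by (metis abs_mult)
    then show ?thesis using lc t'(2) n'(2) by simp
  qed
  have "t2 * n2 dvd t1 * n2" "t2 * n2 dvd n1 * t2"
    using coeffs[of 0] coeffs[of 1] unfolding cm[symmetric] by (auto simp: m0_def abs_dvd_iff) (metis dvd_minus_iff dvd_triv_left)+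
  then have "t2 dvd t1" "n2 dvd n1"
    using t'(2) n'(2) by (auto simp: mult.commute)
  then show "t \<in> \<int>" "n \<in> \<int>"
    using t' n' by (auto elim!: dvdE)
qed

section \<open>Normal form of an imaginary quadratic field\<close>

lemma complex_ring_simps [simp]:
  "carrier complex_ring = UNIV" "x \<otimes>\<^bsub>complex_ring\<^esub> y = x * y" "x \<oplus>\<^bsub>complex_ring\<^esub> y = x + y"
  "\<one>\<^bsub>complex_ring\<^esub> = 1" "\<zero>\<^bsub>complex_ring\<^esub> = 0"
  by (simp_all add: ring_of_type_algebra_def)

interpretation complex_ring: ring complex_ring
  by (rule ring_from_type_algebra)

lemma complex_ring_a_inv [simp]: "\<ominus>\<^bsub>complex_ring\<^esub> x = - x"
  by (rule complex_ring.minus_equality) simp_all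

text \<open>An exchange argument: 1 lies in \<open>K\<close>, so one of two spanning vectors can be
  traded for 1. The other is then non-real because \<open>K\<close> is not contained in the
  reals.\<close>

lemma imaginary_quadratic_field_imp_span:
  assumes "imaginary_quadratic_field K"
  obtains \<theta> where "K = {a + b * \<theta> | a b. a \<in> \<rat> \<and> b \<in> \<rat>}" "\<theta> \<notin> \<real>" "\<theta>\<^sup>2 \<in> K"
proof -
  have sub: "subfield K complex_ring" and dim: "complex_ring.dimension (Suc (Suc 0)) \<rat> K" and nr: "\<not> K \<subseteq> \<real>"
    using assms by (auto simp: imaginary_quadratic_field_def numeral_2_eq_2)
  from dim obtain v w where K: "K = {a * v + b * w | a b. a \<in> \<rat> \<and> b \<in> \<rat>}"
  proof cases
    case (Suc_dim v E)
    from Suc_dim(4) show ?thesis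
    proof cases
      case 2: (Suc_dim w F)
      have "F = {0}"
        using 2(4) by cases auto
      then have "E = (\<lambda>b. b * w) ` \<rat>"
        unfolding 2(1) by (intro Set.set_eqI) (simp add: complex_ring.line_extension_mem_iff image_iff)
      then have "x \<in> K \<longleftrightarrow> (\<exists>a\<in>\<rat>. \<exists>b\<in>\<rat>. x = a * v + b * w)" for x
        unfolding Suc_dim(1) complex_ring.line_extension_mem_iff by simp
      then have "K = {a * v + b * w | a b. a \<in> \<rat> \<and> b \<in> \<rat>}"
        by (intro Set.set_eqI) blast
      then show ?thesis by (rule that)
    qed
  qed
  have K': "K = {a * w + b * v | a b. a \<in> \<rat> \<and> b \<in> \<rat>}"
    unfolding K by (intro Collect_cong) (metis add.commute)
  note subr = subringE[OF subfieldE(1)[OF sub]]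
  have one: "1 \<in> K" and mult: "\<And>x y. x \<in> K \<Longrightarrow> y \<in> K \<Longrightarrow> x * y \<in> K"
    using subr(3,6) by auto
  note \<theta>I = that
  have *: thesis if K: "K = {a * v + b * w | a b. a \<in> \<rat> \<and> b \<in> \<rat>}"
    and ab: "1 = a * v + b * w" "a \<in> \<rat>" "b \<in> \<rat>" "a \<noteq> 0" for a b v w
  proof (rule \<theta>I)
    have v: "v = 1 / a + (- b / a) * w"
      using ab by (simp add: field_simps)
    show K2: "K = {a + b * w | a b. a \<in> \<rat> \<and> b \<in> \<rat>}"
    proof (intro Set.set_eqI iffI)
      fix x assume "x \<in> K"
      then obtain c d where x: "x = c * v + d * w" and cd: "c \<in> \<rat>" "d \<in> \<rat>"
        unfolding K by blast
      have "x = c / a + (d - c * b / a) * w"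
        unfolding x v by (simp add: algebra_simps)
      moreover have "c / a \<in> \<rat>" "d - c * b / a \<in> \<rat>"
        using ab cd by auto
      ultimately show "x \<in> {a + b * w | a b. a \<in> \<rat> \<and> b \<in> \<rat>}" by blast
    next
      fix x assume "x \<in> {a + b * w | a b. a \<in> \<rat> \<and> b \<in> \<rat>}"
      then obtain c d where x: "x = c + d * w" and cd: "c \<in> \<rat>" "d \<in> \<rat>"
        by blast
      have "x = c * (a * v + b * w) + d * w"
        using x by (simp flip: ab(1))
      then have "x = (c * a) * v + (c * b + d) * w"
        by (simp add: algebra_simps)
      moreover have "c * a \<in> \<rat>" "c * b + d \<in> \<rat>" using ab cd by auto
      ultimately show "x \<in> K" unfolding K by blast
    qed
    have "\<rat> \<subseteq> (\<real> :: complex set)"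
      by (auto elim!: Rats_cases')
    then show "w \<notin> \<real>"
      using nr unfolding K2 by (auto intro!: Reals_add Reals_mult)
    have "w \<in> K"
      unfolding K by (rule CollectI, rule exI[of _ 0], rule exI[of _ 1]) simp
    then show "w\<^sup>2 \<in> K"
      unfolding power2_eq_square by (intro mult)
  qed
  obtain a b where ab: "1 = a * v + b * w" "a \<in> \<rat>" "b \<in> \<rat>"
    using one unfolding K by blast
  then consider "a \<noteq> 0" | "b \<noteq> 0" by force
  then show thesis
    using *[OF K ab] *[OF K', of b a] ab by cases (auto simp: add.commute)
qed

lemma Re_of_rat [simp]: "Re (of_rat a) = of_rat a" and Im_of_rat [simp]: "Im (of_rat a) = 0"
proof -
  have "of_rat a = complex_of_real (of_rat a)"
    by (cases a) (simp add: of_rat_rat)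
  then show "Re (of_rat a) = of_rat a" "Im (of_rat a) = 0"
    by simp_all
qed

lemma imaginary_quadratic_field_eq:
  assumes "imaginary_quadratic_field K"
  obtains d :: nat where "squarefree d" "K = {Complex (of_rat a) (of_rat b * sqrt d) | a b. True}"
proof -
  obtain \<theta> where K: "K = {a + b * \<theta> | a b. a \<in> \<rat> \<and> b \<in> \<rat>}" and nr: "\<theta> \<notin> \<real>" and sq: "\<theta>\<^sup>2 \<in> K"
    using imaginary_quadratic_field_imp_span[OF assms] .
  obtain p q :: rat where pq: "\<theta>\<^sup>2 = of_rat p + of_rat q * \<theta>"
    using sq unfolding K by (auto elim!: Rats_cases)
  have im: "Im \<theta> \<noteq> 0" using nr by (simp add: complex_is_Real_iff)
  have req: "Re \<theta> ^ 2 - Im \<theta> ^ 2 = of_rat p + of_rat q * Re \<theta>" "2 * Re \<theta> * Im \<theta> = of_rat q * Im \<theta>"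
    using arg_cong[OF pq, of Re] arg_cong[OF pq, of Im] by (simp_all add: power2_eq_square)
  have re: "Re \<theta> = of_rat (q / 2)"
    using req(2) im by (simp add: of_rat_divide)
  \<comment> \<open>Minus a quarter of the discriminant of X^2 - q X - p, which is the square of the
    imaginary part of \<theta>.\<close>
  define r where "r = - (p + q\<^sup>2 / 4)"
  have "Im \<theta> ^ 2 = of_rat ((q / 2)\<^sup>2 - p - q * (q / 2))"
    using req(1) unfolding re of_rat_diff of_rat_mult of_rat_power by simp
  moreover have "(q / 2)\<^sup>2 - p - q * (q / 2) = r"
    by (simp add: r_def power2_eq_square)
  ultimately have imsq: "Im \<theta> ^ 2 = of_rat r" by simp
  then have "r > 0"
    using im by (metis of_rat_less zero_less_power2 of_rat_0)
  obtain m n where mn: "quotient_of r = (m, n)" by fastforce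
  have r: "r = of_int m / of_int n" and n: "n > 0"
    using mn quotient_of_div quotient_of_denom_pos by blast+
  have m: "m > 0"
    using \<open>r > 0\<close> n unfolding r by (simp add: zero_less_divide_iff)
  \<comment> \<open>Since m / n = m n / n^2, the integer m n has the same class as \<open>r\<close>
    modulo rational squares.\<close>
  define d where "d = squarefree_part (nat (m * n))"
  define f where "f = square_part (nat (m * n))"
  have df: "nat (m * n) = d * f\<^sup>2"
    unfolding d_def f_def by (rule squarefree_decompose)
  have f: "f > 0"
    using df mult_pos_pos[OF m n] by (cases "f = 0") auto
  have "real_of_int (m * n) = of_nat (nat (m * n))"
    using m n by simp
  then have mnf: "real_of_int (m * n) = real d * real f ^ 2"
    unfolding df by simp
  have "real_of_rat r = real_of_int (m * n) / (of_int n)\<^sup>2"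
    unfolding r using n by (simp add: of_rat_divide power2_eq_square)
  then have rr: "real_of_rat r = real d * (real f / of_int n)\<^sup>2"
    unfolding mnf by (simp add: power_divide)
  have "\<bar>Im \<theta>\<bar> = sqrt (Im \<theta> ^ 2)" by simp
  also have "\<dots> = sqrt d * (real f / of_int n)"
    unfolding imsq rr using n by (simp add: real_sqrt_mult)
  finally have absim: "\<bar>Im \<theta>\<bar> = sqrt d * (real f / of_int n)" .
  define g :: rat where "g = (if Im \<theta> > 0 then 1 else -1) * of_nat f / of_int n"
  have "g \<noteq> 0" using f n by (simp add: g_def)
  have "Im \<theta> = (if Im \<theta> > 0 then 1 else -1) * \<bar>Im \<theta>\<bar>" by simp
  also have "\<dots> = of_rat g * sqrt d"
    unfolding absim by (simp add: g_def of_rat_divide of_rat_mult of_rat_minus)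
  finally have g: "Im \<theta> = of_rat g * sqrt d" .
  have \<theta>: "\<theta> = Complex (of_rat (q / 2)) (of_rat g * sqrt d)"
    using re g by (simp add: complex_eq_iff)
  have lin: "of_rat a + of_rat b * \<theta> = Complex (of_rat (a + b * q / 2)) (of_rat (b * g) * sqrt d)" for a b
    unfolding \<theta> by (simp add: complex_eq_iff of_rat_add of_rat_mult of_rat_divide)
  have "K = {Complex (of_rat a) (of_rat b * sqrt d) | a b. True}"
  proof (intro Set.set_eqI iffI)
    fix x assume "x \<in> K"
    then show "x \<in> {Complex (of_rat a) (of_rat b * sqrt d) | a b. True}"
      unfolding K by (auto elim!: Rats_cases simp: lin)
  next
    fix x assume "x \<in> {Complex (of_rat a) (of_rat b * sqrt d) | a b. True}"
    then obtain a b where x: "x = Complex (of_rat a) (of_rat b * sqrt d)" by blast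
    have "x = of_rat (a - b / g * q / 2) + of_rat (b / g) * \<theta>"
      unfolding lin x using \<open>g \<noteq> 0\<close> by simp
    then show "x \<in> K"
      unfolding K by (intro CollectI exI conjI) (assumption, simp_all)
  qed
  with that[of d] show thesis by (simp add: d_def)
qed

text \<open>For \<open>D \<equiv> 0, 3 (mod 4)\<close>, \<open>quad_order D\<close> is the quadratic order of discriminant \<open>-D\<close>.\<close>

definition quad_gen :: "nat \<Rightarrow> complex" where
  "quad_gen D = Complex (D / 2) (sqrt D / 2)"

definition quad_order :: "nat \<Rightarrow> complex set" where
  "quad_order D = {of_int a + of_int b * quad_gen D | a b. True}"

lemma quad_orderI: "x = of_int a + of_int b * quad_gen D \<Longrightarrow> x \<in> quad_order D"
  unfolding quad_order_def by blast

lemma quad_orderE: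
  assumes "x \<in> quad_order D"
  obtains a b where "x = of_int a + of_int b * quad_gen D"
  using assms unfolding quad_order_def by blast

lemma quad_order_expand:
  "of_int a + of_int b * quad_gen D = Complex (of_int a + of_int b * D / 2) (of_int b * sqrt D / 2)"
  by (simp add: quad_gen_def complex_eq_iff)

lemma of_int_in_quad_order [simp]: "of_int a \<in> quad_order D"
  by (rule quad_orderI[of _ a 0]) simp

text \<open>D (D + 1) / 4 is the norm of \<open>quad_gen D\<close>; its integrality makes the span
  of 1 and \<open>quad_gen D\<close> closed under multiplication.\<close>

lemma four_dvd_mult_Suc:
  fixes D :: nat
  assumes "D mod 4 = 0 \<or> D mod 4 = 3"
  shows "4 dvd D * (D + 1)"
proof -
  have "4 dvd D \<or> 4 dvd D + 1" using assms by presburger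
  then show ?thesis by (metis dvd_mult dvd_mult2)
qed

lemma quad_gen_sq:
  assumes "D mod 4 = 0 \<or> D mod 4 = 3"
  shows "quad_gen D ^ 2 = of_int (int D) * quad_gen D - of_int (int (D * (D + 1) div 4))"
proof -
  have "4 dvd D * (D + 1)" by (rule four_dvd_mult_Suc[OF assms])
  then have *: "real (D * (D + 1) div 4) = real D * (real D + 1) / 4"
    by (subst real_of_nat_div) (auto simp: algebra_simps)
  show ?thesis
    using * by (simp add: quad_gen_def complex_eq_iff power2_eq_square field_simps)
qed

lemma quad_order_add: "x \<in> quad_order D \<Longrightarrow> y \<in> quad_order D \<Longrightarrow> x + y \<in> quad_order D"
proof (elim quad_orderE)
  fix a b a' b' assume "x = of_int a + of_int b * quad_gen D" "y = of_int a' + of_int b' * quad_gen D"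
  then show ?thesis by (intro quad_orderI[of _ "a + a'" "b + b'"]) (simp add: algebra_simps)
qed

lemma quad_order_uminus: "x \<in> quad_order D \<Longrightarrow> - x \<in> quad_order D"
proof (elim quad_orderE)
  fix a b assume "x = of_int a + of_int b * quad_gen D"
  then show ?thesis by (intro quad_orderI[of _ "- a" "- b"]) (simp add: algebra_simps)
qed

lemma quad_order_diff: "x \<in> quad_order D \<Longrightarrow> y \<in> quad_order D \<Longrightarrow> x - y \<in> quad_order D"
  using quad_order_add[of x D "- y"] quad_order_uminus[of y D] by simp

lemma quad_order_mult:
  assumes D: "D mod 4 = 0 \<or> D mod 4 = 3" and "x \<in> quad_order D" "y \<in> quad_order D"
  shows "x * y \<in> quad_order D"
proof -
  obtain a b a' b' where xy: "x = of_int a + of_int b * quad_gen D" "y = of_int a' + of_int b' * quad_gen D"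
    using assms(2,3) by (elim quad_orderE) blast
  define t where "t = int (D * (D + 1) div 4)"
  have "x * y = of_int (a * a') + of_int (a * b' + a' * b) * quad_gen D + of_int (b * b') * quad_gen D ^ 2"
    by (simp add: xy power2_eq_square algebra_simps)
  also have "\<dots> = of_int (a * a' - b * b' * t) + of_int (a * b' + a' * b + b * b' * int D) * quad_gen D"
    unfolding quad_gen_sq[OF D] t_def[symmetric] by (simp add: algebra_simps)
  finally show ?thesis by (rule quad_orderI)
qed

lemma algebraic_int_quad_order:
  assumes D: "D mod 4 = 0 \<or> D mod 4 = 3" and "x \<in> quad_order D"
  shows "algebraic_int x"
proof -
  obtain a b where x: "x = of_int a + of_int b * quad_gen D"
    using assms(2) by (elim quad_orderE)
  define t where "t = int (D * (D + 1) div 4)"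
  define T where "T = 2 * a + b * int D"
  define N where "N = a\<^sup>2 + a * b * int D + b\<^sup>2 * t"
  have "x\<^sup>2 = of_int (a\<^sup>2) + of_int (2 * a * b) * quad_gen D + of_int (b\<^sup>2) * quad_gen D ^ 2"
    by (simp add: x power2_eq_square algebra_simps)
  also have "\<dots> = of_int T * x - of_int N"
    unfolding quad_gen_sq[OF D] t_def[symmetric] x T_def N_def by (simp add: algebra_simps power2_eq_square)
  finally have eq: "x\<^sup>2 = of_int T * x - of_int N" .
  show ?thesis
  proof (rule algebraic_int.intros[of "[:of_int N, - of_int T, 1:]"])
    show "\<forall>i. poly.coeff [:of_int N, - of_int T, 1:] i \<in> (\<int> :: complex set)"
      by (auto simp: coeff_pCons split: nat.split)
    show "poly [:of_int N, - of_int T, 1:] x = 0"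
      using eq by (simp add: power2_eq_square algebra_simps)
  qed simp
qed

lemma square_mod_4: "(u :: int)\<^sup>2 mod 4 = u mod 2"
proof (cases "even u")
  case True
  then obtain k where "u = 2 * k" by (elim evenE)
  then have "u\<^sup>2 = 4 * (k * k)" by (simp add: power2_eq_square algebra_simps)
  then show ?thesis using True by presburger
next
  case False
  then obtain k where "u = 2 * k + 1" by (elim oddE)
  then have "u\<^sup>2 = 4 * (k * k + k) + 1" by (simp add: power2_eq_square algebra_simps)
  then have "u\<^sup>2 mod 4 = 1" by presburger
  then show ?thesis using False by presburger
qed

text \<open>The squared denominator of \<open>b\<close> is coprime to the numerator, hence divides
  \<open>d\<close>. Applied to \<open>2 * b\<close>, this leaves at most a 2 in the denominator of
  the coefficient of sqrt(-d) in an algebraic integer.\<close>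

lemma squarefree_times_rat_square_int:
  fixes b :: rat and d :: nat
  assumes "squarefree d" "of_nat d * b\<^sup>2 = of_int M"
  shows "b \<in> \<int>"
proof -
  obtain w z where b: "quotient_of b = (w, z)" by fastforce
  have z: "z > 0" and wz: "b = of_int w / of_int z" "coprime w z"
    using b quotient_of_denom_pos quotient_of_div quotient_of_coprime by blast+
  have "(of_int (int d * w\<^sup>2) :: rat) = of_int (M * z\<^sup>2)"
    using assms(2) z by (simp add: wz(1) field_simps)
  then have "int d * w\<^sup>2 = M * z\<^sup>2" by (simp only: of_int_eq_iff)
  then have "z\<^sup>2 dvd int d * w\<^sup>2" by simp
  then have "z\<^sup>2 dvd int d"
    using wz(2) by (simp add: coprime_commute coprime_dvd_mult_left_iff)
  then have "int ((nat z)\<^sup>2) dvd int d"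
    using z by simp
  then have "(nat z)\<^sup>2 dvd d"
    by (simp only: int_dvd_int_iff)
  then have "nat z dvd 1"
    using assms(1) squarefreeD by blast
  then have "z = 1" using z by simp
  then show ?thesis using wz(1) by simp
qed

lemma quad_order_ring_of_integers:
  assumes sf: "squarefree d" and K: "K = {Complex (of_rat a) (of_rat b * sqrt d) | a b. True}"
  shows "ring_of_integers K = quad_order (if d mod 4 = 3 then d else 4 * d)"
proof -
  define D where "D = (if d mod 4 = 3 then d else 4 * d)"
  have D: "D mod 4 = 0 \<or> D mod 4 = 3" by (simp add: D_def)
  have d4: "d mod 4 \<noteq> 0"
    using squarefreeD[OF sf, of 2] by (auto simp: dvd_eq_mod_eq_0)
  then have d0: "d > 0" by (cases d) auto
  have in_order: "Complex (of_rat a) (of_rat b * sqrt d) \<in> quad_order D"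
    if t: "2 * a = of_int u" and w: "2 * b = of_int w" and N: "a\<^sup>2 + of_nat d * b\<^sup>2 = of_int N" for a b u w N
  proof -
    have "(of_int (u\<^sup>2 + int d * w\<^sup>2) :: rat) = (2 * a)\<^sup>2 + of_nat d * (2 * b)\<^sup>2"
      unfolding t w by simp
    also have "\<dots> = 4 * (a\<^sup>2 + of_nat d * b\<^sup>2)"
      by (simp add: power2_eq_square algebra_simps)
    also have "\<dots> = of_int (4 * N)" unfolding N by simp
    finally have "u\<^sup>2 + int d * w\<^sup>2 = 4 * N" by (simp only: of_int_eq_iff)
    then have "(u\<^sup>2 + int d * w\<^sup>2) mod 4 = 0" by simp
    then have "(u\<^sup>2 mod 4 + (int d mod 4) * (w\<^sup>2 mod 4)) mod 4 = 0"
      by (metis mod_add_eq mod_mult_eq mod_mod_trivial)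
    then have m: "(u mod 2 + (int d mod 4) * (w mod 2)) mod 4 = 0"
      by (simp only: square_mod_4)
    have im4: "int d mod 4 = int (d mod 4)" by (simp add: zmod_int)
    have a: "of_rat a = of_int u / (2::real)" and b: "of_rat b = of_int w / (2::real)"
      using arg_cong[OF t, of "of_rat :: rat \<Rightarrow> real"] arg_cong[OF w, of "of_rat :: rat \<Rightarrow> real"]
      by (simp_all add: of_rat_mult)
    have "d mod 4 = 1 \<or> d mod 4 = 2 \<or> d mod 4 = 3" using d4 by presburger
    \<comment> \<open>As 4 does not divide \<open>d\<close>, the vanishing of u^2 + d w^2 modulo 4
      makes \<open>u\<close> and \<open>w\<close> even, except for d = 3 modulo 4, where they only
      share their parity.\<close>
    then have par: "(d mod 4 = 3 \<and> even (u - w)) \<or> (d mod 4 \<noteq> 3 \<and> even u \<and> even w)"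
      using m unfolding im4 by (elim disjE) (simp_all, presburger+)
    show ?thesis
    proof (cases "d mod 4 = 3")
      case True
      then have "odd d" by presburger
      then have "even (u - w * int d)"
        using par True by simp
      then obtain k where k: "u - w * int d = 2 * k" by (elim evenE)
      have "real_of_int u = real_of_int w * real d + 2 * real_of_int k"
        using arg_cong[OF k, of real_of_int] by simp
      then have "Complex (of_rat a) (of_rat b * sqrt d) = of_int k + of_int w * quad_gen D"
        unfolding quad_order_expand a b using True by (simp add: D_def)
      then show ?thesis by (rule quad_orderI)
    next
      case False
      then obtain k l where "u = 2 * k" "w = 2 * l" using par by (auto elim!: evenE)
      then have "Complex (of_rat a) (of_rat b * sqrt d) = of_int (k - 2 * l * int d) + of_int l * quad_gen D"
        unfolding quad_order_expand a b using False by (simp add: D_def real_sqrt_mult)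
      then show ?thesis by (rule quad_orderI)
    qed
  qed
  have "ring_of_integers K = quad_order D"
  proof (intro Set.set_eqI iffI)
    fix x assume "x \<in> ring_of_integers K"
    then have x: "x \<in> K" "algebraic_int x" by (auto simp: ring_of_integers_def)
    then obtain a b where xab: "x = Complex (of_rat a) (of_rat b * sqrt d)" unfolding K by blast
    show "x \<in> quad_order D"
    proof (cases "b = 0")
      case True
      then have xa: "x = of_rat a" using xab by (simp add: complex_eq_iff)
      then have "x \<in> \<int>" using rational_algebraic_int_is_int[OF x(2)] by simp
      then show ?thesis by (auto elim!: Ints_cases)
    next
      case False
      have im: "Im x \<noteq> 0" using False d0 by (simp add: xab)
      have t: "2 * Re x = of_rat (2 * a)" and n: "(cmod x)\<^sup>2 = of_rat (a\<^sup>2 + of_nat d * b\<^sup>2)"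
        unfolding cmod_power2 by (simp_all add: xab of_rat_mult of_rat_add of_rat_power power_mult_distrib)
      obtain u N where uN: "2 * a = of_int u" "a\<^sup>2 + of_nat d * b\<^sup>2 = of_int N"
        using algebraic_int_quadratic[OF x(2) im t n] by (auto elim!: Ints_cases)
      have "of_nat d * (2 * b)\<^sup>2 = 4 * (a\<^sup>2 + of_nat d * b\<^sup>2) - (2 * a)\<^sup>2"
        by (simp add: power2_eq_square algebra_simps)
      also have "\<dots> = of_int (4 * N - u\<^sup>2)" unfolding uN by simp
      finally have "2 * b \<in> \<int>" by (rule squarefree_times_rat_square_int[OF sf])
      then obtain w where "2 * b = of_int w" by (elim Ints_cases)
      then show ?thesis unfolding xab using in_order[OF uN(1) _ uN(2)] by blast
    qed
  next
    fix x assume x: "x \<in> quad_order D"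
    then obtain a b where xab: "x = of_int a + of_int b * quad_gen D" by (elim quad_orderE)
    have "x = Complex (of_rat (of_int a + of_int b * of_nat D / 2))
      (of_rat (of_int b * (if d mod 4 = 3 then 1 / 2 else 1)) * sqrt d)"
      unfolding xab quad_order_expand
      by (simp add: D_def of_rat_add of_rat_mult of_rat_divide real_sqrt_mult)
    then have "x \<in> K" unfolding K by blast
    with algebraic_int_quad_order[OF D x] show "x \<in> ring_of_integers K"
      by (simp add: ring_of_integers_def)
  qed
  then show ?thesis by (simp add: D_def)
qed

theorem imaginary_quadratic_ring_of_integers:
  assumes "imaginary_quadratic_field K"
  obtains D where "D mod 4 = 0 \<or> D mod 4 = 3" "D > 0" "D \<noteq> 12" "ring_of_integers K = quad_order D"
proof -
  obtain d :: nat where d: "squarefree d" "K = {Complex (of_rat a) (of_rat b * sqrt d) | a b. True}"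
    using imaginary_quadratic_field_eq[OF assms] .
  have "d \<noteq> 0" using squarefreeD[OF d(1), of 2] by (cases "d = 0") auto
  show thesis
  proof (rule that[OF _ _ _ quad_order_ring_of_integers[OF d]])
    \<comment> \<open>The value 12 belongs to Z[sqrt(-3)], which is not the full ring of
      integers.\<close>
    have "4 * d \<noteq> 12" if "d mod 4 \<noteq> 3" using that by presburger
    then show "(if d mod 4 = 3 then d else 4 * d) \<noteq> 12" by auto
  qed (use \<open>d \<noteq> 0\<close> in simp_all)
qed

section \<open>Euclidean functions\<close>

text \<open>Norms are integers, so the floors in the Euclidean function and in the later descent
  lose nothing.\<close>

lemma quad_order_cmod_square:
  assumes D: "D mod 4 = 0 \<or> D mod 4 = 3" and "x \<in> quad_order D"
  obtains n :: nat where "(cmod x)\<^sup>2 = real n"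
proof -
  obtain a b where x: "x = of_int a + of_int b * quad_gen D"
    using assms(2) by (elim quad_orderE)
  obtain t where t: "D * (D + 1) = 4 * t"
    using four_dvd_mult_Suc[OF D] by (elim dvdE)
  then have t': "real D * (real D + 1) = 4 * real t"
    by (metis of_nat_mult of_nat_add of_nat_1 of_nat_numeral)
  have "(of_int b * sqrt (real D) / 2)\<^sup>2 = (of_int b)\<^sup>2 * real D / 4"
    by (simp add: power_mult_distrib power_divide)
  then have "(cmod x)\<^sup>2 = (of_int a + of_int b * real D / 2)\<^sup>2 + (of_int b)\<^sup>2 * real D / 4"
    by (simp only: x quad_order_expand cmod_power2 complex.sel)
  also have "\<dots> = (of_int a)\<^sup>2 + of_int a * of_int b * real D + (of_int b)\<^sup>2 * (real D * (real D + 1) / 4)"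
    by (simp add: power2_eq_square algebra_simps add_divide_distrib)
  also have "\<dots> = of_int (a\<^sup>2 + a * b * int D + b\<^sup>2 * int t)"
    unfolding t' by simp
  finally have eq: "(cmod x)\<^sup>2 = of_int (a\<^sup>2 + a * b * int D + b\<^sup>2 * int t)" .
  then have "a\<^sup>2 + a * b * int D + b\<^sup>2 * int t \<ge> 0"
    by (metis of_int_0_le_iff zero_le_power2)
  with eq show ?thesis by (intro that[of "nat (a\<^sup>2 + a * b * int D + b\<^sup>2 * int t)"]) simp
qed

text \<open>The lattice consists of rows at vertical spacing sqrt D / 2. Rounding to the nearest row
  and then within it leaves errors of at most sqrt D / 4 and 1/2, and 1/4 + D/16 < 1 exactly when D
  < 12.\<close>

lemma quad_order_covering:
  assumes "0 < D" "D < 12"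
  obtains q where "q \<in> quad_order D" "cmod (z - q) < 1"
proof -
  define s where "s = sqrt D"
  have s: "s > 0" "s\<^sup>2 = D" using assms by (simp_all add: s_def)
  define b where "b = round (2 * Im z / s)"
  define a where "a = round (Re z - of_int b * D / 2)"
  define q where "q = of_int a + of_int b * quad_gen D"
  have "\<bar>2 * Im z / s - of_int b\<bar> \<le> 1 / 2"
    unfolding b_def using of_int_round_abs_le[of "2 * Im z / s"] by (simp add: abs_minus_commute)
  then have le: "\<bar>2 * Im z / s - of_int b\<bar> * (s / 2) \<le> 1 / 2 * (s / 2)"
    using s(1) by (intro mult_right_mono) auto
  have "Im (z - q) = (2 * Im z / s - of_int b) * (s / 2)"
    using s(1) by (simp add: q_def quad_gen_def field_simps flip: s_def)
  then have "\<bar>Im (z - q)\<bar> = \<bar>2 * Im z / s - of_int b\<bar> * (s / 2)"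
    using s(1) by (simp only: abs_mult)
  with le have "\<bar>Im (z - q)\<bar> \<le> s / 4" by linarith
  then have im: "(Im (z - q))\<^sup>2 \<le> (s / 4)\<^sup>2"
    using s(1) by (simp add: abs_le_square_iff[symmetric])
  have "\<bar>Re (z - q)\<bar> \<le> 1 / 2"
    using of_int_round_abs_le[of "Re z - of_int b * D / 2"]
    by (simp add: q_def quad_gen_def a_def abs_minus_commute algebra_simps)
  then have re: "(Re (z - q))\<^sup>2 \<le> (1 / 2)\<^sup>2"
    by (simp add: abs_le_square_iff[symmetric])
  have "(cmod (z - q))\<^sup>2 \<le> 1 / 4 + D / 16"
    using re im s(2) unfolding cmod_power2 by (simp add: power_divide)
  also have "\<dots> < 1\<^sup>2" using assms by simp
  finally have "cmod (z - q) < 1" by (rule power2_less_imp_less) simp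
  then show ?thesis by (intro that[of q]) (auto simp: q_def intro: quad_orderI)
qed

lemma domain_quad_order:
  assumes D: "D mod 4 = 0 \<or> D mod 4 = 3"
  shows "domain (complex_ring\<lparr>carrier := quad_order D\<rparr>)"
proof -
  have field: "field complex_ring" by (rule field_from_type_algebra)
  have "subring (quad_order D) complex_ring"
    using of_int_in_quad_order[of 1 D]
    by (intro complex_ring.subringI)
      (auto intro: quad_order_add quad_order_mult[OF D] quad_order_uminus)
  then have "subdomain (quad_order D) complex_ring"
    using field by (intro domain.subdomainI') (auto dest: field.axioms)
  then show ?thesis by (rule complex_ring.subdomain_is_domain)
qed

theorem euclidean_quad_order:
  assumes D: "D mod 4 = 0 \<or> D mod 4 = 3" "0 < D" "D < 12"
  shows "is_euclidean_domain (quad_order D)"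
proof -
  define \<phi> where "\<phi> = (\<lambda>x. nat \<lfloor>(cmod x)\<^sup>2\<rfloor>)"
  have "euclidean_domain (complex_ring\<lparr>carrier := quad_order D\<rparr>) \<phi>"
  proof (rule euclidean_domain.intro[OF domain_quad_order[OF D(1)]], unfold_locales, goal_cases)
    case (1 a b)
    then have ab: "a \<in> quad_order D" "b \<in> quad_order D" "b \<noteq> 0" by auto
    obtain q where q: "q \<in> quad_order D" "cmod (a / b - q) < 1"
      using quad_order_covering[OF D(2,3)] .
    define r where "r = a - b * q"
    have r: "r \<in> quad_order D"
      unfolding r_def by (intro quad_order_diff quad_order_mult D(1) ab q(1))
    have "r = b * (a / b - q)" using ab(3) by (simp add: r_def algebra_simps)
    then have "cmod r < cmod b * 1"
      using q(2) ab(3) unfolding norm_mult by (metis mult_strict_left_mono zero_less_norm_iff norm_mult)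
    then have lt: "(cmod r)\<^sup>2 < (cmod b)\<^sup>2" by (simp add: power_strict_mono)
    obtain m n :: nat where "(cmod r)\<^sup>2 = m" "(cmod b)\<^sup>2 = n"
      using quad_order_cmod_square[OF D(1)] r ab(2) by metis
    then have "\<phi> r < \<phi> b" using lt by (simp add: \<phi>_def)
    then show ?case using q(1) r by (intro exI[of _ q] exI[of _ r]) (simp add: r_def)
  qed
  then show ?thesis unfolding is_euclidean_domain_def by blast
qed

text \<open>An element off the real row has an imaginary part of at least sqrt D / 2 in absolute
  value. Elements that are short enough are therefore rational integers.\<close>

lemma quad_order_cmod_ge:
  assumes "x \<in> quad_order D" "x \<notin> \<int>"
  shows "(cmod x)\<^sup>2 \<ge> D / 4"
proof -
  obtain a b where x: "x = of_int a + of_int b * quad_gen D"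
    using assms(1) by (elim quad_orderE)
  have "b \<noteq> 0" using assms(2) by (auto simp: x)
  then have "b\<^sup>2 \<ge> 1" by (simp add: int_one_le_iff_zero_less)
  then have "real_of_int (b\<^sup>2) \<ge> 1" by (simp only: of_int_1_le_iff)
  then have "1 * (real D / 4) \<le> (of_int b)\<^sup>2 * (real D / 4)"
    by (intro mult_right_mono) auto
  also have "\<dots> = (Im x)\<^sup>2"
    by (simp add: x quad_gen_def power_mult_distrib power_divide)
  also have "\<dots> \<le> (cmod x)\<^sup>2" unfolding cmod_power2 by simp
  finally show ?thesis by simp
qed

text \<open>Motzkin's argument: a non-unit \<open>x\<close> minimising the Euclidean function leaves only the
  remainders \<open>0, 1, -1\<close>; applied to \<open>2\<close> this forces \<open>x\<close> to be a rational integer, and then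
  the generator of the order has no admissible remainder.\<close>

theorem not_euclidean_quad_order:
  assumes "D > 14"
  shows "\<not> is_euclidean_domain (quad_order D)"
proof
  assume "is_euclidean_domain (quad_order D)"
  then obtain \<phi> where "euclidean_domain (complex_ring\<lparr>carrier := quad_order D\<rparr>) \<phi>"
    unfolding is_euclidean_domain_def by blast
  from euclidean_domain.euclidean_function[OF this]
  have euclid: "\<exists>q r. q \<in> quad_order D \<and> r \<in> quad_order D \<and> a = b * q + r \<and> (r = 0 \<or> \<phi> r < \<phi> b)"
    if "a \<in> quad_order D" "a \<noteq> 0" "b \<in> quad_order D" "b \<noteq> 0" for a b
    using that by simp
  \<comment> \<open>For such \<open>D\<close> the only units are 1 and -1, so \<open>W\<close>
    consists of the nonzero non-units.\<close>
  define W where "W = quad_order D - {0, 1, -1}"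
  have "2 \<in> W" using of_int_in_quad_order[of 2 D] by (simp add: W_def)
  then obtain x where x: "x \<in> W" and min: "\<And>y. y \<in> W \<Longrightarrow> \<phi> x \<le> \<phi> y"
    using ex_has_least_nat[of "\<lambda>x. x \<in> W" 2 \<phi>] by blast
  have xO: "x \<in> quad_order D" "x \<noteq> 0" using x by (auto simp: W_def)
  have rem: "\<exists>q\<in>quad_order D. \<exists>r\<in>{0, 1, -1}. a = x * q + r" if a: "a \<in> quad_order D" "a \<noteq> 0" for a
  proof -
    obtain q r where qr: "q \<in> quad_order D" "r \<in> quad_order D" "a = x * q + r" "r = 0 \<or> \<phi> r < \<phi> x"
      using euclid[OF a xO] by blast
    have "r \<in> {0, 1, -1}"
    proof (rule ccontr)
      assume "r \<notin> {0, 1, -1}"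
      then have "r \<in> W" "r \<noteq> 0" using qr(2) by (auto simp: W_def)
      then show False using min qr(4) by (metis leD)
    qed
    with qr show ?thesis by blast
  qed
  have "x \<in> \<int>"
  proof (rule ccontr)
    assume nx: "x \<notin> \<int>"
    have "2 \<in> quad_order D" using of_int_in_quad_order[of 2 D] by simp
    then obtain q r where q: "q \<in> quad_order D" and r: "r \<in> {0, 1, -1}" "2 = x * q + r"
      using rem[OF _ zero_neq_numeral[symmetric]] by blast
    \<comment> \<open>Here x q = 2 - r has squared absolute value at most 9, while a non-rational
      \<open>x\<close> contributes at least 15/4. So |q|^2 is at most 12/5: \<open>q\<close> is a
      rational integer, necessarily 1 or -1, and \<open>x\<close> would be rational after
      all.\<close>
    have xq: "x * q \<in> {1, 2, 3}" using r by (auto simp: algebra_simps)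
    then have "cmod (x * q) \<le> 3" by auto
    then have "(cmod (x * q))\<^sup>2 \<le> 3\<^sup>2" by (intro power_mono) auto
    then have le: "(cmod x)\<^sup>2 * (cmod q)\<^sup>2 \<le> 9" by (simp add: norm_mult power_mult_distrib)
    have x15: "(cmod x)\<^sup>2 \<ge> 15 / 4"
      using quad_order_cmod_ge[OF xO(1) nx] assms by simp
    have "15 / 4 * (cmod q)\<^sup>2 \<le> (cmod x)\<^sup>2 * (cmod q)\<^sup>2"
      using x15 by (intro mult_right_mono) auto
    then have q4: "(cmod q)\<^sup>2 < 15 / 4" using le by simp
    then have "q \<in> \<int>"
      using quad_order_cmod_ge[OF q] assms by (cases "q \<in> \<int>") auto
    then obtain k where k: "q = of_int k" by (elim Ints_cases)
    have "k \<noteq> 0" using xq k by auto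
    have "k = 1 \<or> k = -1"
    proof (rule ccontr)
      assume "\<not> ?thesis"
      then have "\<bar>k\<bar> \<ge> 2" using \<open>k \<noteq> 0\<close> by linarith
      then have "real_of_int \<bar>k\<bar> \<ge> 2" by simp
      then have "(real_of_int \<bar>k\<bar>)\<^sup>2 \<ge> 2\<^sup>2" by (intro power_mono) auto
      then show False using q4 by (simp add: k)
    qed
    then have "x = x * q \<or> x = - (x * q)" using k by auto
    moreover have "x * q \<in> \<int>" using xq by auto
    ultimately show False using nx by (metis Ints_minus)
  qed
  then obtain m where m: "x = of_int m" by (elim Ints_cases)
  have g: "quad_gen D \<in> quad_order D" by (rule quad_orderI[of _ 0 1]) simp
  have "quad_gen D \<noteq> 0" using assms by (simp add: quad_gen_def complex_eq_iff)
  then obtain q r where q: "q \<in> quad_order D" and r: "r \<in> {0, 1, -1}" "quad_gen D = x * q + r"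
    using rem[OF g] by blast
  obtain a b where ab: "q = of_int a + of_int b * quad_gen D" using q by (elim quad_orderE)
  \<comment> \<open>With \<open>x\<close> the rational integer \<open>m\<close>, comparing imaginary
    parts gives m b = 1, so \<open>x\<close> would be a unit.\<close>
  have "Im (quad_gen D) = Im (x * q)" using r by auto
  then have "sqrt D / 2 = of_int m * (of_int b * (sqrt D / 2))"
    by (simp add: m ab quad_gen_def)
  then have "real_of_int (m * b) = 1" using assms by (simp add: field_simps)
  then have "m * b = 1" by (simp only: of_int_eq_1_iff)
  then have "m = 1 \<or> m = -1" by (auto simp: zmult_eq_1_iff)
  then show False using x by (auto simp: W_def m)
qed

section \<open>Moebius transformations and circles\<close>

definition mat2 :: "complex \<Rightarrow> complex \<Rightarrow> complex \<Rightarrow> complex \<Rightarrow> complex^2^2" where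
  "mat2 a b c d = vector [vector [a, b], vector [c, d]]"

lemma mat2_nth [simp]:
  "mat2 a b c d $ 1 $ 1 = a" "mat2 a b c d $ 1 $ 2 = b" "mat2 a b c d $ 2 $ 1 = c" "mat2 a b c d $ 2 $ 2 = d"
  by (simp_all add: mat2_def)

lemma mat2_in_SL2_iff:
  "mat2 a b c d \<in> SL2 R \<longleftrightarrow> a \<in> R \<and> b \<in> R \<and> c \<in> R \<and> d \<in> R \<and> a * d - b * c = 1"
  by (auto simp: SL2_def forall_2 det_2)

lemma SL2E:
  assumes "A \<in> SL2 R"
  obtains a b c d where "A = mat2 a b c d" "a \<in> R" "b \<in> R" "c \<in> R" "d \<in> R" "a * d - b * c = 1"
proof (rule that)
  show "A = mat2 (A$1$1) (A$1$2) (A$2$1) (A$2$2)" by (simp add: vec_eq_iff forall_2)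
qed (use assms in \<open>auto simp: SL2_def det_2\<close>)

lemma mat2_mult:
  "mat2 a b c d ** mat2 a' b' c' d' = mat2 (a * a' + b * c') (a * b' + b * d') (c * a' + d * c') (c * b' + d * d')"
  by (simp add: vec_eq_iff forall_2 matrix_matrix_mult_def sum_2)

text \<open>Homogeneous coordinates, in which Moebius transformations act linearly and infinity
  needs no separate treatment. The meaningless pair (0, 0) also yields \<open>None\<close>, so the
  lemmas require a nonzero coordinate.\<close>

definition proj_point :: "complex \<Rightarrow> complex \<Rightarrow> complex option" where
  "proj_point x y = (if y = 0 then None else Some (x / y))"

lemma mobius_proj_point:
  assumes "x \<noteq> 0 \<or> y \<noteq> 0"
  shows "mobius (mat2 a b c d) (proj_point x y) = proj_point (a * x + b * y) (c * x + d * y)"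
proof (cases "y = 0")
  case True
  then show ?thesis using assms by (simp add: proj_point_def)
next
  case False
  define m n where "m = a * x + b * y" and "n = c * x + d * y"
  have "c * (x / y) + d = n / y" "a * (x / y) + b = m / y"
    using False by (simp_all add: m_def n_def add_divide_distrib)
  then have "mobius (mat2 a b c d) (Some (x / y)) = proj_point m n"
    using False by (simp only: mobius.simps mat2_nth) (simp add: proj_point_def)
  then show ?thesis using False by (simp add: proj_point_def m_def n_def)
qed

lemma proj_point_cases:
  obtains x y where "z = proj_point x y" "x \<noteq> 0 \<or> y \<noteq> 0"
proof (cases z)
  case None
  then show ?thesis by (intro that[of 1 0]) (simp_all add: proj_point_def)
next
  case (Some w)
  then show ?thesis by (intro that[of w 1]) (simp_all add: proj_point_def)
qed

lemma extended_reals_cases: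
  assumes "z \<in> extended_reals"
  obtains x y :: real where "z = proj_point x y" "x \<noteq> 0 \<or> y \<noteq> 0"
proof (cases z)
  case None
  then show ?thesis by (intro that[of 1 0]) (simp_all add: proj_point_def)
next
  case (Some w)
  then have "w \<in> \<real>" using assms by (auto simp: extended_reals_def)
  then obtain x where "w = of_real x" by (elim Reals_cases)
  then show ?thesis using Some by (intro that[of x 1]) (simp_all add: proj_point_def)
qed

lemma mobius_mult:
  assumes "A \<in> SL2 R" "B \<in> SL2 R"
  shows "mobius (A ** B) z = mobius A (mobius B z)"
proof -
  obtain a b c d where A: "A = mat2 a b c d" using assms(1) by (elim SL2E)
  obtain a' b' c' d' where B: "B = mat2 a' b' c' d'" "a' * d' - b' * c' = 1"
    using assms(2) by (elim SL2E)
  obtain x y where z: "z = proj_point x y" "x \<noteq> 0 \<or> y \<noteq> 0" by (rule proj_point_cases)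
  \<comment> \<open>The adjugate of \<open>B\<close> recovers (x, y) from its image, so the image
    vector is not zero.\<close>
  have "d' * (a' * x + b' * y) - b' * (c' * x + d' * y) = (a' * d' - b' * c') * x"
    "a' * (c' * x + d' * y) - c' * (a' * x + b' * y) = (a' * d' - b' * c') * y"
    by (simp_all add: algebra_simps)
  then have "a' * x + b' * y \<noteq> 0 \<or> c' * x + d' * y \<noteq> 0"
    using z(2) B(2) by auto
  then show ?thesis
    unfolding A B(1) z(1) mat2_mult mobius_proj_point[OF z(2)]
    by (subst mobius_proj_point) (auto simp: algebra_simps)
qed

section \<open>The arrangement as an orbit, and the equations of its circles\<close>

definition SL2_orbit_reals :: "complex set \<Rightarrow> complex option set" where
  "SL2_orbit_reals R = (\<Union>A\<in>SL2 R. mobius A ` extended_reals)"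

lemma schmidt_arrangement_eq: "schmidt_arrangement K = SL2_orbit_reals (ring_of_integers K)"
proof -
  have "schmidt_circles K = (\<lambda>A. mobius A ` extended_reals) ` SL2 (ring_of_integers K)"
    unfolding schmidt_circles_def PSL2_def quotient_def
    by (force simp: PSL2_act_class image_iff)
  then show ?thesis by (simp add: schmidt_arrangement_def SL2_orbit_reals_def)
qed

lemma SL2_quad_order_mult:
  assumes "D mod 4 = 0 \<or> D mod 4 = 3" "A \<in> SL2 (quad_order D)" "B \<in> SL2 (quad_order D)"
  shows "A ** B \<in> SL2 (quad_order D)"
proof -
  obtain a b c d where A: "A = mat2 a b c d" using assms(2) by (elim SL2E)
  obtain a' b' c' d' where B: "B = mat2 a' b' c' d'" using assms(3) by (elim SL2E)
  have "det (A ** B) = 1" using assms(2,3) by (simp add: det_mul SL2_def)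
  then show ?thesis
    using assms(2,3) unfolding A B mat2_mult mat2_in_SL2_iff
    by (auto simp: det_2 intro!: quad_order_add quad_order_mult[OF assms(1)])
qed

lemma SL2_orbit_reals_mobius:
  assumes D: "D mod 4 = 0 \<or> D mod 4 = 3" and A: "A \<in> SL2 (quad_order D)"
    and z: "z \<in> SL2_orbit_reals (quad_order D)"
  shows "mobius A z \<in> SL2_orbit_reals (quad_order D)"
proof -
  obtain B r where B: "B \<in> SL2 (quad_order D)" "z = mobius B r" "r \<in> extended_reals"
    using z by (auto simp: SL2_orbit_reals_def)
  have "mobius A z = mobius (A ** B) r" using mobius_mult[OF A B(1)] B(2) by simp
  then show ?thesis
    using SL2_quad_order_mult[OF D A B(1)] B(3) by (auto simp: SL2_orbit_reals_def)
qed

lemma SL2_orbit_reals_translate: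
  assumes D: "D mod 4 = 0 \<or> D mod 4 = 3" and "q \<in> quad_order D"
    and "Some w \<in> SL2_orbit_reals (quad_order D)"
  shows "Some (w + q) \<in> SL2_orbit_reals (quad_order D)"
proof -
  have "mat2 1 q 0 1 \<in> SL2 (quad_order D)"
    using assms(2) of_int_in_quad_order[of 1 D] of_int_in_quad_order[of 0 D] by (simp add: mat2_in_SL2_iff)
  from SL2_orbit_reals_mobius[OF D this assms(3)] show ?thesis by simp
qed

text \<open>The circle \<open>A(\<real>)\<close> is \<open>a |w|\<^sup>2 - Im (\<xi> w) + c = 0\<close> with \<open>a = Im (\<delta> cnj \<beta>)\<close>,
  \<open>c = Im (\<gamma> cnj \<alpha>)\<close> and \<open>\<xi> = \<delta> cnj \<alpha> - \<beta> cnj \<gamma>\<close>, a Hermitian form of discriminant \<open>1\<close>.\<close>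

lemma SL2_circle_equation:
  fixes \<alpha> \<beta> \<gamma> \<delta> w :: complex
  assumes det: "\<alpha> * \<delta> - \<gamma> * \<beta> = 1" and r: "r \<in> extended_reals"
    and w: "Some w = mobius (mat2 \<alpha> \<gamma> \<beta> \<delta>) r"
  defines "\<xi> \<equiv> \<delta> * cnj \<alpha> - \<beta> * cnj \<gamma>"
  shows "Im (\<xi> * w) = Im (\<delta> * cnj \<beta>) * (cmod w)\<^sup>2 + Im (\<gamma> * cnj \<alpha>)"
    and "(cmod \<xi>)\<^sup>2 = 1 + 4 * Im (\<delta> * cnj \<beta>) * Im (\<gamma> * cnj \<alpha>)"
proof -
  obtain x y :: real where xy: "r = proj_point x y" "x \<noteq> 0 \<or> y \<noteq> 0"
    using r by (elim extended_reals_cases)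
  define e where "e = \<beta> * x + \<delta> * y"
  have "Some w = proj_point (\<alpha> * x + \<gamma> * y) e"
    using w xy(2) unfolding xy(1) e_def by (subst (asm) mobius_proj_point) auto
  then have e: "e \<noteq> 0" and we: "w * e = \<alpha> * x + \<gamma> * y"
    by (auto simp: proj_point_def split: if_splits)
  \<comment> \<open>Numerator and denominator of the inverse transformation at \<open>w\<close>:
    multiplied by \<open>e\<close> they return the real coordinates of \<open>r\<close>, so the
    product of one with the conjugate of the other is real.\<close>
  have "(\<delta> * w - \<gamma>) * e = \<delta> * (w * e) - \<gamma> * e" by (simp add: algebra_simps)
  also have "\<dots> = (\<alpha> * \<delta> - \<gamma> * \<beta>) * x" unfolding we by (simp add: e_def algebra_simps)
  finally have 1: "(\<delta> * w - \<gamma>) * e = x" by (simp add: det)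
  have "(\<alpha> - \<beta> * w) * e = \<alpha> * e - \<beta> * (w * e)" by (simp add: algebra_simps)
  also have "\<dots> = (\<alpha> * \<delta> - \<gamma> * \<beta>) * y" unfolding we by (simp add: e_def algebra_simps)
  finally have 2: "(\<alpha> - \<beta> * w) * e = y" by (simp add: det)
  have "(\<delta> * w - \<gamma>) * cnj (\<alpha> - \<beta> * w) * (e * cnj e) = ((\<delta> * w - \<gamma>) * e) * cnj ((\<alpha> - \<beta> * w) * e)"
    by simp
  also have "\<dots> = of_real (x * y)" unfolding 1 2 by simp
  finally have "(\<delta> * w - \<gamma>) * cnj (\<alpha> - \<beta> * w) * of_real ((cmod e)\<^sup>2) = of_real (x * y)"
    by (simp only: complex_norm_square[symmetric] of_real_power)
  then have "Im ((\<delta> * w - \<gamma>) * cnj (\<alpha> - \<beta> * w) * of_real ((cmod e)\<^sup>2)) = 0"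
    by (simp only: Im_complex_of_real)
  then have "Im ((\<delta> * w - \<gamma>) * cnj (\<alpha> - \<beta> * w)) * (cmod e)\<^sup>2 = 0"
    by simp
  then have "Im ((\<delta> * w - \<gamma>) * cnj (\<alpha> - \<beta> * w)) = 0"
    using e by simp
  then show "Im (\<xi> * w) = Im (\<delta> * cnj \<beta>) * (cmod w)\<^sup>2 + Im (\<gamma> * cnj \<alpha>)"
    unfolding cmod_power2 by (simp add: \<xi>_def power2_eq_square algebra_simps)
  have "(cmod \<xi>)\<^sup>2 - 4 * Im (\<delta> * cnj \<beta>) * Im (\<gamma> * cnj \<alpha>) = (cmod (\<alpha> * \<delta> - \<gamma> * \<beta>))\<^sup>2"
    unfolding cmod_power2 by (simp add: \<xi>_def power2_eq_square algebra_simps)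
  then show "(cmod \<xi>)\<^sup>2 = 1 + 4 * Im (\<delta> * cnj \<beta>) * Im (\<gamma> * cnj \<alpha>)"
    by (simp add: det)
qed

lemma quad_order_cnj:
  assumes "x \<in> quad_order D"
  shows "cnj x \<in> quad_order D"
proof -
  obtain a b where x: "x = of_int a + of_int b * quad_gen D" using assms by (elim quad_orderE)
  show ?thesis
    by (rule quad_orderI[of _ "a + b * int D" "- b"]) (simp add: x quad_gen_def complex_eq_iff algebra_simps)
qed

lemma quad_order_Im:
  assumes "x \<in> quad_order D"
  obtains k :: int where "Im x = of_int k * sqrt D / 2"
proof -
  obtain a b where "x = of_int a + of_int b * quad_gen D" using assms by (elim quad_orderE)
  then show ?thesis by (intro that[of b]) (simp add: quad_gen_def)
qed

text \<open>Replacing each conjugate in \<xi> by z - 2 i Im z, where Im z is an integer multiple of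
  sqrt D / 2, turns \<xi> into the determinant 1 minus sqrt(-D) times an element of the order. This
  is the congruence that the ghost circle violates.\<close>

lemma schmidt_circle_coefficients:
  assumes D: "D mod 4 = 0 \<or> D mod 4 = 3" and "Some w \<in> SL2_orbit_reals (quad_order D)"
  obtains a c p q :: real and m n k :: int where
    "p = 1 + of_int n * real D / 2" "q = - (sqrt D * (of_int m + of_int n * real D / 2))"
    "a + c = of_int k * sqrt D / 2" "p\<^sup>2 + q\<^sup>2 = 1 + 4 * a * c"
    "p * Im w + q * Re w = a * ((Re w)\<^sup>2 + (Im w)\<^sup>2) + c"
proof -
  obtain M r where M: "M \<in> SL2 (quad_order D)" "r \<in> extended_reals" "Some w = mobius M r"
    using assms(2) by (auto simp: SL2_orbit_reals_def)
  obtain \<alpha> \<gamma> \<beta> \<delta> where m: "M = mat2 \<alpha> \<gamma> \<beta> \<delta>" and O: "\<alpha> \<in> quad_order D" "\<gamma> \<in> quad_order D"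
    "\<beta> \<in> quad_order D" "\<delta> \<in> quad_order D" and det: "\<alpha> * \<delta> - \<gamma> * \<beta> = 1"
    using M(1) by (elim SL2E)
  define \<xi> where "\<xi> = \<delta> * cnj \<alpha> - \<beta> * cnj \<gamma>"
  define a where "a = Im (\<delta> * cnj \<beta>)"
  define c where "c = Im (\<gamma> * cnj \<alpha>)"
  note eqs = SL2_circle_equation[OF det M(2) M(3)[unfolded m], folded \<xi>_def a_def c_def]
  have "\<delta> * cnj \<beta> + \<gamma> * cnj \<alpha> \<in> quad_order D"
    by (intro quad_order_add quad_order_mult D quad_order_cnj O)
  then obtain k :: int where "Im (\<delta> * cnj \<beta> + \<gamma> * cnj \<alpha>) = of_int k * sqrt D / 2"
    by (rule quad_order_Im)
  then have k: "a + c = of_int k * sqrt D / 2" by (simp add: a_def c_def)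
  obtain u :: int where u: "Im \<alpha> = of_int u * sqrt D / 2" using O(1) by (rule quad_order_Im)
  obtain v :: int where v: "Im \<gamma> = of_int v * sqrt D / 2" using O(2) by (rule quad_order_Im)
  define \<eta> where "\<eta> = of_int u * \<delta> - of_int v * \<beta>"
  have "\<eta> \<in> quad_order D"
    unfolding \<eta>_def by (intro quad_order_diff quad_order_mult D O of_int_in_quad_order)
  then obtain A B where \<eta>: "\<eta> = of_int A + of_int B * quad_gen D" by (elim quad_orderE)
  have cnj: "cnj z = z - 2 * \<i> * of_real (Im z)" for z by (simp add: complex_eq_iff)
  have "\<xi> = (\<alpha> * \<delta> - \<gamma> * \<beta>) - 2 * \<i> * (of_real (Im \<alpha>) * \<delta> - of_real (Im \<gamma>) * \<beta>)"
    unfolding \<xi>_def cnj[of \<alpha>] cnj[of \<gamma>] by (simp add: algebra_simps)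
  also have "\<dots> = 1 - \<i> * of_real (sqrt D) * \<eta>"
    unfolding det u v \<eta>_def by (simp add: algebra_simps)
  finally have \<xi>: "\<xi> = 1 - \<i> * of_real (sqrt D) * \<eta>" .
  show thesis
  proof (rule that[of "Re \<xi>" B "Im \<xi>" A a c k])
    show "Re \<xi> = 1 + of_int B * real D / 2" "Im \<xi> = - (sqrt D * (of_int A + of_int B * real D / 2))"
      unfolding \<xi> \<eta> by (simp_all add: quad_gen_def)
    show "(Re \<xi>)\<^sup>2 + (Im \<xi>)\<^sup>2 = 1 + 4 * a * c"
      using eqs(2) unfolding cmod_power2 .
    show "Re \<xi> * Im w + Im \<xi> * Re w = a * ((Re w)\<^sup>2 + (Im w)\<^sup>2) + c"
      using eqs(1) unfolding cmod_power2 by simp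
  qed (rule k)
qed

section \<open>Connectedness in the Euclidean case\<close>

lemma openin_riemann_sphere_cases:
  assumes "openin riemann_sphere V"
  obtains (finite) U where "open U" "V = Some ` U"
    | (infinity) C where "compact C" "V = insert None (Some ` (- C))"
  using assms unfolding riemann_sphere_def openin_Alexandroff_compactification
  by (auto simp: Compl_eq_Diff_UNIV)

lemma openin_riemann_sphere_finite: "open U \<Longrightarrow> openin riemann_sphere (Some ` U)"
  by (simp add: riemann_sphere_def)

lemma openin_riemann_sphere_infinity:
  "compact C \<Longrightarrow> openin riemann_sphere (insert None (Some ` (- C)))"
  unfolding riemann_sphere_def openin_Alexandroff_compactification
  by (intro disjI2 exI[of _ C]) (auto simp: Compl_eq_Diff_UNIV compact_imp_closed)

lemma topspace_riemann_sphere [simp]: "topspace riemann_sphere = UNIV"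
  by (auto simp: riemann_sphere_def intro: option.exhaust)

lemma continuous_map_riemann_sphereI:
  assumes "\<And>U. open U \<Longrightarrow> openin riemann_sphere (f -` Some ` U)"
    and "\<And>C. compact C \<Longrightarrow> openin riemann_sphere (f -` insert None (Some ` (- C)))"
  shows "continuous_map riemann_sphere riemann_sphere f"
  unfolding continuous_map_def
proof (intro conjI allI impI)
  fix V assume "openin riemann_sphere V"
  then have "openin riemann_sphere (f -` V)"
    by (cases rule: openin_riemann_sphere_cases) (use assms in auto)
  then show "openin riemann_sphere {x \<in> topspace riemann_sphere. f x \<in> V}"
    by (simp add: vimage_def)
qed simp

lemma vimage_option_eq:
  "f -` V = (if f None \<in> V then insert None (Some ` {z. f (Some z) \<in> V}) else Some ` {z. f (Some z) \<in> V})"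
proof (intro Set.set_eqI)
  fix x show "x \<in> f -` V \<longleftrightarrow> x \<in> (if f None \<in> V then insert None (Some ` {z. f (Some z) \<in> V}) else Some ` {z. f (Some z) \<in> V})"
    by (cases x) auto
qed

lemma continuous_map_affine:
  assumes "a \<noteq> 0"
  shows "continuous_map riemann_sphere riemann_sphere (map_option (\<lambda>z. a * z + b))"
proof (rule continuous_map_riemann_sphereI)
  fix U :: "complex set" assume "open U"
  then have "open ((\<lambda>z. a * z + b) -` U)"
    by (intro open_vimage continuous_intros)
  moreover have "map_option (\<lambda>z. a * z + b) -` Some ` U = Some ` ((\<lambda>z. a * z + b) -` U)"
    by (subst vimage_option_eq) auto
  ultimately show "openin riemann_sphere (map_option (\<lambda>z. a * z + b) -` Some ` U)"
    by (simp add: openin_riemann_sphere_finite)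
next
  fix C :: "complex set" assume "compact C"
  then have "compact ((\<lambda>w. (w - b) / a) ` C)"
    using assms by (intro compact_continuous_image continuous_intros) auto
  moreover have "map_option (\<lambda>z. a * z + b) -` insert None (Some ` (- C))
      = insert None (Some ` (- ((\<lambda>w. (w - b) / a) ` C)))"
  proof -
    have "a * z + b \<in> C \<longleftrightarrow> z \<in> (\<lambda>w. (w - b) / a) ` C" for z
      using assms by (force simp: image_iff field_simps)
    then have "{z. a * z + b \<notin> C} = - ((\<lambda>w. (w - b) / a) ` C)" by blast
    then show ?thesis by (subst vimage_option_eq) (simp add: inj_image_mem_iff)
  qed
  ultimately show "openin riemann_sphere (map_option (\<lambda>z. a * z + b) -` insert None (Some ` (- C)))"
    by (simp add: openin_riemann_sphere_infinity)
qed

definition sphere_inv :: "complex option \<Rightarrow> complex option" where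
  "sphere_inv z = (case z of None \<Rightarrow> Some 0 | Some w \<Rightarrow> if w = 0 then None else Some (- 1 / w))"

text \<open>Infinity is sent to 0, so a preimage contains infinity exactly when the given open set
  contains 0. In that case its complement has to be compact; otherwise openness in the plane
  suffices.\<close>

lemma continuous_map_sphere_inv: "continuous_map riemann_sphere riemann_sphere sphere_inv"
proof (rule continuous_map_riemann_sphereI)
  fix U :: "complex set" assume U: "open U"
  define W where "W = {z. z \<noteq> 0 \<and> - 1 / z \<in> U}"
  have "W = (- {0}) \<inter> (\<lambda>z. - 1 / z) -` U" by (auto simp: W_def)
  moreover have "open \<dots>"
    using U by (intro continuous_open_preimage continuous_intros) auto
  ultimately have W: "open W" by simp
  have eq: "{z. sphere_inv (Some z) \<in> Some ` U} = W"
    by (auto simp: sphere_inv_def W_def)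
  show "openin riemann_sphere (sphere_inv -` Some ` U)"
  proof (cases "0 \<in> U")
    case False
    then have "sphere_inv -` Some ` U = Some ` W"
      by (subst vimage_option_eq) (auto simp: eq, auto simp: sphere_inv_def)
    then show ?thesis using W by (simp add: openin_riemann_sphere_finite)
  next
    case True
    then obtain e where e: "e > 0" "ball 0 e \<subseteq> U" using U openE by blast
    have "- W \<subseteq> cball 0 (1 / e)"
    proof
      fix z assume z: "z \<in> - W"
      show "z \<in> cball 0 (1 / e)"
      proof (rule ccontr)
        assume "z \<notin> cball 0 (1 / e)"
        then have "1 / e < cmod z" by simp
        moreover have "1 / e > 0" using e(1) by simp
        ultimately have z0: "z \<noteq> 0" by auto
        then have "cmod (- 1 / z) < e"
          using e(1) \<open>1 / e < cmod z\<close> by (simp add: norm_divide field_simps)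
        then have "z \<in> W" using z0 e(2) by (auto simp: W_def)
        then show False using z by simp
      qed
    qed
    then have "compact (- W)"
      using W by (simp add: compact_eq_bounded_closed closed_def bounded_subset[OF bounded_cball])
    moreover have "sphere_inv -` Some ` U = insert None (Some ` (- (- W)))"
      using True by (subst vimage_option_eq) (auto simp: eq, auto simp: sphere_inv_def)
    ultimately show ?thesis by (simp add: openin_riemann_sphere_infinity del: Compl_partition double_compl)
  qed
next
  fix C :: "complex set" assume C: "compact C"
  define W where "W = {z. z = 0 \<or> - 1 / z \<notin> C}"
  have eq: "{z. sphere_inv (Some z) \<in> insert None (Some ` (- C))} = W"
    by (auto simp: sphere_inv_def W_def)
  show "openin riemann_sphere (sphere_inv -` insert None (Some ` (- C)))"
  proof (cases "0 \<in> C")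
    case False
    have "compact ((\<lambda>z. - 1 / z) ` C)"
      using C False by (intro compact_continuous_image continuous_intros) auto
    moreover have "W = - ((\<lambda>z. - 1 / z) ` C)"
    proof (intro Set.set_eqI iffI)
      fix z assume "z \<in> W"
      then show "z \<in> - ((\<lambda>z. - 1 / z) ` C)" using False by (auto simp: W_def)
    next
      fix z assume z: "z \<in> - ((\<lambda>z. - 1 / z) ` C)"
      show "z \<in> W"
      proof (rule ccontr)
        assume "z \<notin> W"
        then have "- 1 / z \<in> C" "z = - 1 / (- 1 / z)" by (auto simp: W_def)
        then show False using z by blast
      qed
    qed
    moreover have "sphere_inv -` insert None (Some ` (- C)) = insert None (Some ` W)"
      using False by (subst vimage_option_eq) (simp only: eq, simp add: sphere_inv_def)
    ultimately show ?thesis by (simp add: openin_riemann_sphere_infinity)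
  next
    case True
    obtain M where M: "M > 0" "\<And>z. z \<in> C \<Longrightarrow> cmod z \<le> M"
      using compact_imp_bounded[OF C] unfolding bounded_pos by blast
    have "- W = {z. 1 / M \<le> cmod z} \<inter> (\<lambda>z. - 1 / z) -` C"
    proof (intro Set.set_eqI iffI)
      fix z assume "z \<in> - W"
      then have z: "z \<noteq> 0" "- 1 / z \<in> C" by (auto simp: W_def)
      then have "1 / cmod z \<le> M" using M(2)[of "- 1 / z"] by (simp add: norm_divide)
      then show "z \<in> {z. 1 / M \<le> cmod z} \<inter> (\<lambda>z. - 1 / z) -` C"
        using z M(1) by (simp add: field_simps)
    next
      fix z assume z: "z \<in> {z. 1 / M \<le> cmod z} \<inter> (\<lambda>z. - 1 / z) -` C"
      moreover have "1 / M > 0" using M(1) by simp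
      ultimately show "z \<in> - W" by (auto simp: W_def)
    qed
    moreover have "closed ({z. 1 / M \<le> cmod z} \<inter> (\<lambda>z. - 1 / z) -` C)"
    proof (rule continuous_closed_preimage)
      have "1 / M > 0" using M(1) by simp
      then show "continuous_on {z. 1 / M \<le> cmod z} (\<lambda>z. - 1 / z :: complex)"
        by (intro continuous_intros) auto
      show "closed {z :: complex. 1 / M \<le> cmod z}" by (intro closed_Collect_le continuous_intros)
      show "closed C" using C by (rule compact_imp_closed)
    qed
    ultimately have "closed (- W)" by (simp only:)
    then have "open W" by (simp add: closed_def)
    moreover have "sphere_inv -` insert None (Some ` (- C)) = Some ` W"
      using True by (subst vimage_option_eq) (simp only: eq, auto simp: sphere_inv_def)
    ultimately show ?thesis by (simp add: openin_riemann_sphere_finite)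
  qed
qed

text \<open>The real line is connected and has infinity in its closure, since the complement of a
  compact set contains large reals.\<close>

lemma connectedin_extended_reals: "connectedin riemann_sphere extended_reals"
proof (rule connectedin_intermediate_closure_of)
  have "connected (\<real> :: complex set)"
    unfolding Reals_def by (intro connected_continuous_image continuous_intros) simp
  then have "connectedin euclidean (\<real> :: complex set)" by simp
  then show "connectedin riemann_sphere (Some ` (\<real> :: complex set))"
    unfolding riemann_sphere_def
    by (rule connectedin_continuous_map_image[OF continuous_map_Some])
  show "Some ` \<real> \<subseteq> extended_reals" by (auto simp: extended_reals_def)
  have "None \<in> riemann_sphere closure_of Some ` \<real>"
    unfolding in_closure_of
  proof (intro conjI allI impI)
    fix V assume V: "None \<in> V \<and> openin riemann_sphere V"
    then obtain C where C: "compact C" "V = insert None (Some ` (- C))"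
      by (metis None_notin_image_Some openin_riemann_sphere_cases)
    obtain M where M: "\<And>z. z \<in> C \<Longrightarrow> cmod z \<le> M"
      using C(1) compact_imp_bounded bounded_iff by metis
    have "of_real (\<bar>M\<bar> + 1) \<notin> C" using M[of "of_real (\<bar>M\<bar> + 1)"] by (auto simp del: of_real_add)
    then show "\<exists>y. y \<in> Some ` \<real> \<and> y \<in> V"
      unfolding C(2) by (intro exI[of _ "Some (of_real (\<bar>M\<bar> + 1))"]) auto
  qed simp
  moreover have "Some ` \<real> \<subseteq> riemann_sphere closure_of (Some ` \<real>)"
    by (rule closure_of_subset) simp
  ultimately show "extended_reals \<subseteq> riemann_sphere closure_of (Some ` \<real>)"
    by (simp add: extended_reals_def)
qed

lemma continuous_map_mobius_upper:
  assumes "d \<noteq> 0" "a \<noteq> 0"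
  shows "continuous_map riemann_sphere riemann_sphere (mobius (mat2 a b 0 d))"
proof -
  have "mobius (mat2 a b 0 d) = map_option (\<lambda>z. (a / d) * z + b / d)"
  proof
    fix z show "mobius (mat2 a b 0 d) z = map_option (\<lambda>z. (a / d) * z + b / d) z"
      using assms by (cases z) (simp_all add: add_divide_distrib)
  qed
  then show ?thesis using continuous_map_affine[of "a / d" "b / d"] assms by simp
qed

lemma continuous_map_mobius_division:
  "continuous_map riemann_sphere riemann_sphere (mobius (mat2 q (- 1) 1 0))"
proof -
  have "mobius (mat2 q (- 1) 1 0) = map_option (\<lambda>z. 1 * z + q) \<circ> sphere_inv"
  proof
    fix z show "mobius (mat2 q (- 1) 1 0) z = (map_option (\<lambda>z. 1 * z + q) \<circ> sphere_inv) z"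
      by (cases z) (simp_all add: sphere_inv_def field_simps)
  qed
  then show ?thesis
    using continuous_map_compose[OF continuous_map_sphere_inv continuous_map_affine[of 1 q]] by simp
qed

section \<open>Chains of circles by Euclidean descent\<close>

lemma SL2_one: "0 \<in> R \<Longrightarrow> 1 \<in> R \<Longrightarrow> mat2 1 0 0 1 \<in> SL2 R"
  by (simp add: mat2_in_SL2_iff)

lemma mobius_one [simp]: "mobius (mat2 1 0 0 1) z = z"
  by (cases z) simp_all

text \<open>Euclidean descent on the lower left entry. Writing \<open>A = E B\<close> with \<open>E z = q - 1 / z\<close>, the circle
  \<open>E(\<real>)\<close> meets \<open>\<real>\<close> at \<open>\<infinity>\<close>, so a connected set joining \<open>\<real>\<close> to \<open>B(\<real>)\<close> is carried by \<open>E\<close> to one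
  joining \<open>E(\<real>)\<close>, hence \<open>\<real>\<close>, to \<open>A(\<real>)\<close>.\<close>

lemma connected_chain:
  assumes D: "D mod 4 = 0 \<or> D mod 4 = 3" "0 < D" "D < 12" and "A \<in> SL2 (quad_order D)"
  shows "\<exists>T. connectedin riemann_sphere T \<and> T \<subseteq> SL2_orbit_reals (quad_order D) \<and>
    extended_reals \<subseteq> T \<and> mobius A ` extended_reals \<subseteq> T"
  using assms(4)
proof (induction "nat \<lfloor>(cmod (A$2$1))\<^sup>2\<rfloor>" arbitrary: A rule: less_induct)
  case less
  let ?S = "SL2_orbit_reals (quad_order D)"
  have O: "0 \<in> quad_order D" "1 \<in> quad_order D"
    using of_int_in_quad_order[of 0 D] of_int_in_quad_order[of 1 D] by simp_all
  have ext: "extended_reals \<subseteq> ?S"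
    unfolding SL2_orbit_reals_def using SL2_one[OF O] by force
  obtain a b c d where A: "A = mat2 a b c d" and abcd: "a \<in> quad_order D" "b \<in> quad_order D"
    "c \<in> quad_order D" "d \<in> quad_order D" "a * d - b * c = 1"
    using less.prems by (elim SL2E)
  show ?case
  proof (cases "c = 0")
    case True
    then have "a \<noteq> 0" "d \<noteq> 0" using abcd(5) by auto
    then have "connectedin riemann_sphere (mobius A ` extended_reals)"
      unfolding A True
      by (intro connectedin_continuous_map_image[OF continuous_map_mobius_upper connectedin_extended_reals])
    moreover have "None \<in> mobius A ` extended_reals"
      by (rule image_eqI[of _ _ None]) (simp_all add: A True extended_reals_def)
    then have "extended_reals \<inter> mobius A ` extended_reals \<noteq> {}"
      by (auto simp: extended_reals_def)
    ultimately have "connectedin riemann_sphere (extended_reals \<union> mobius A ` extended_reals)"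
      by (intro connectedin_Un connectedin_extended_reals)
    moreover have "mobius A ` extended_reals \<subseteq> ?S"
      using less.prems by (auto simp: SL2_orbit_reals_def)
    ultimately show ?thesis using ext by blast
  next
    case False
    obtain q where q: "q \<in> quad_order D" "cmod (a / c - q) < 1"
      using quad_order_covering[OF D(2,3)] .
    define E where "E = mat2 q (- 1) 1 0"
    \<comment> \<open>This is the inverse of \<open>E\<close> times \<open>A\<close>; its lower left
      entry is minus the remainder of \<open>a\<close> modulo \<open>c\<close>.\<close>
    define B where "B = mat2 c d (q * c - a) (q * d - b)"
    have E: "E \<in> SL2 (quad_order D)"
      using O q(1) quad_order_uminus[OF O(2)] by (simp add: E_def mat2_in_SL2_iff)
    have B: "B \<in> SL2 (quad_order D)"
      unfolding B_def mat2_in_SL2_iff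
      using abcd by (auto intro!: quad_order_diff quad_order_mult[OF D(1)] q(1) simp: algebra_simps)
    have EB: "A = E ** B" by (simp add: A E_def B_def mat2_mult)
    have "q * c - a = - (c * (a / c - q))" using False by (simp add: algebra_simps)
    then have "cmod (q * c - a) = cmod c * cmod (a / c - q)" by (simp add: norm_mult)
    also have "\<dots> < cmod c * 1" using q(2) False by (intro mult_strict_left_mono) auto
    finally have lt: "(cmod (q * c - a))\<^sup>2 < (cmod c)\<^sup>2" by (simp add: power_strict_mono)
    have "q * c - a \<in> quad_order D"
      by (intro quad_order_diff quad_order_mult[OF D(1)] q(1) abcd)
    then obtain m n :: nat where "(cmod (q * c - a))\<^sup>2 = m" "(cmod c)\<^sup>2 = n"
      using quad_order_cmod_square[OF D(1)] abcd(3) by metis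
    then have "nat \<lfloor>(cmod (B$2$1))\<^sup>2\<rfloor> < nat \<lfloor>(cmod (A$2$1))\<^sup>2\<rfloor>"
      using lt by (simp add: A B_def)
    from less.hyps[OF this B] obtain T where T: "connectedin riemann_sphere T" "T \<subseteq> ?S"
      "extended_reals \<subseteq> T" "mobius B ` extended_reals \<subseteq> T" by blast
    have ET: "connectedin riemann_sphere (mobius E ` T)"
      unfolding E_def by (rule connectedin_continuous_map_image[OF continuous_map_mobius_division T(1)])
    \<comment> \<open>0 is the pole of \<open>E\<close>, so the image of \<open>T\<close> passes
      through infinity and meets the extended reals there.\<close>
    have "Some 0 \<in> T" using T(3) by (auto simp: extended_reals_def)
    then have "mobius E (Some 0) \<in> mobius E ` T" by (rule imageI)
    then have "None \<in> mobius E ` T" by (simp add: E_def)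
    then have "extended_reals \<inter> mobius E ` T \<noteq> {}" by (auto simp: extended_reals_def)
    then have "connectedin riemann_sphere (extended_reals \<union> mobius E ` T)"
      by (intro connectedin_Un connectedin_extended_reals ET)
    moreover have "mobius E ` T \<subseteq> ?S"
      using SL2_orbit_reals_mobius[OF D(1) E] T(2) by blast
    moreover have "mobius A ` extended_reals \<subseteq> mobius E ` T"
      using T(4) unfolding EB by (auto simp: mobius_mult[OF E B])
    ultimately show ?thesis using ext by blast
  qed
qed

text \<open>The connected sets supplied by \<open>connected_chain\<close> all contain infinity, so
  their union is connected, and it exhausts the orbit.\<close>

theorem connected_SL2_orbit_quad_order:
  assumes D: "D mod 4 = 0 \<or> D mod 4 = 3" "0 < D" "D < 12"
  shows "connectedin riemann_sphere (SL2_orbit_reals (quad_order D))"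
proof -
  let ?S = "SL2_orbit_reals (quad_order D)"
  define \<T> where "\<T> = {T. connectedin riemann_sphere T \<and> T \<subseteq> ?S \<and> extended_reals \<subseteq> T}"
  have "?S \<subseteq> \<Union>\<T>"
  proof
    fix z assume "z \<in> ?S"
    then obtain A where "A \<in> SL2 (quad_order D)" "z \<in> mobius A ` extended_reals"
      by (auto simp: SL2_orbit_reals_def)
    then show "z \<in> \<Union>\<T>" using connected_chain[OF D, of A] unfolding \<T>_def by blast
  qed
  moreover have "\<Union>\<T> \<subseteq> ?S" by (auto simp: \<T>_def)
  ultimately have "?S = \<Union>\<T>" by (rule subset_antisym)
  moreover have "None \<in> \<Inter>\<T>" by (auto simp: \<T>_def extended_reals_def)
  then have "connectedin riemann_sphere (\<Union>\<T>)"
    by (intro connectedin_Union) (auto simp: \<T>_def)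
  ultimately show ?thesis by simp
qed

section \<open>The ghost circle\<close>

text \<open>The radius makes the ghost circle orthogonal to the unit circles around \<open>0\<close> and \<open>1\<close>. For odd \<open>D\<close>
  its centre is the circumcentre of \<open>0\<close>, \<open>1\<close> and \<open>(1 + \<surd>-D)/2\<close>, for even \<open>D\<close> that of the rectangle
  spanned by \<open>1\<close> and \<open>\<surd>-D/2\<close>.\<close>

definition ghost_height :: "nat \<Rightarrow> real" where
  "ghost_height D = (if D mod 4 = 0 then sqrt D / 4 else (real D - 1) / (4 * sqrt D))"

definition ghost_center :: "nat \<Rightarrow> complex" where
  "ghost_center D = Complex (1 / 2) (ghost_height D)"

definition ghost_radius :: "nat \<Rightarrow> real" where
  "ghost_radius D = sqrt ((ghost_height D)\<^sup>2 - 3 / 4)"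

text \<open>Up to scaling, the squared term is the inversive product of the circle
  \<open>a |w|\<^sup>2 - Im (\<xi> w) + c = 0\<close>, \<open>\<xi> = p + i q\<close>, with the ghost circle; two circles that meet have
  inversive product at most \<open>1\<close>.\<close>

lemma inversive_product_le:
  fixes a c p q x y h :: real
  assumes "p\<^sup>2 + q\<^sup>2 = 1 + 4 * a * c" "p * y + q * x = a * (x\<^sup>2 + y\<^sup>2) + c"
    and circ: "(x - 1 / 2)\<^sup>2 + (y - h)\<^sup>2 = h\<^sup>2 - 3 / 4"
  shows "(p * h + q / 2 - (a + c))\<^sup>2 \<le> h\<^sup>2 - 3 / 4"
proof -
  \<comment> \<open>In coordinates about the ghost centre, eliminating x^2 + y^2 by the equation of
    the ghost circle leaves a linear equation in \<open>u\<close> and \<open>v\<close>. Lagrange's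
    identity then gives a Cauchy-Schwarz bound on that circle.\<close>
  define u where "u = x - 1 / 2"
  define v where "v = y - h"
  define m where "m = q - a"
  define n where "n = p - 2 * a * h"
  have xy: "x\<^sup>2 + y\<^sup>2 = x + 2 * h * y - 1"
    using circ by (simp add: power2_eq_square algebra_simps)
  have lin: "m * u + n * v = c - a - m / 2 - n * h"
    using assms(2) unfolding xy u_def v_def m_def n_def by (simp add: algebra_simps)
  have "(m\<^sup>2 + n\<^sup>2) * (u\<^sup>2 + v\<^sup>2) - (m * u + n * v)\<^sup>2 = (m * v - n * u)\<^sup>2"
    by (simp add: power2_eq_square algebra_simps)
  then have "(c - a - m / 2 - n * h)\<^sup>2 \<le> (m\<^sup>2 + n\<^sup>2) * (h\<^sup>2 - 3 / 4)"
    using circ unfolding lin u_def[symmetric] v_def[symmetric] by (metis diff_ge_0_iff_ge zero_le_power2)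
  moreover have "(m\<^sup>2 + n\<^sup>2) * (h\<^sup>2 - 3 / 4) - (c - a - m / 2 - n * h)\<^sup>2
      = (p\<^sup>2 + q\<^sup>2 - 4 * a * c) * (h\<^sup>2 - 3 / 4) - (p * h + q / 2 - (a + c))\<^sup>2"
    unfolding m_def n_def by (simp add: power2_eq_square field_simps)
  ultimately show ?thesis using assms(1) by simp
qed

text \<open>The scaled inversive product is an odd multiple of the ghost height for even
  \<open>D\<close>, and (D - 1 - 2 D j) / (4 sqrt D) with an integer j for odd \<open>D\<close>.
  Either way its least possible absolute value is the ghost height.\<close>

lemma ghost_height_le:
  fixes D :: nat and m n k :: int
  assumes D: "D mod 4 = 0 \<or> D mod 4 = 3"
    and p: "p = 1 + of_int n * real D / 2" and q: "q = - (sqrt D * (of_int m + of_int n * real D / 2))"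
    and k: "t = of_int k * sqrt D / 2"
  shows "(ghost_height D)\<^sup>2 \<le> (p * ghost_height D + q / 2 - t)\<^sup>2"
proof (cases "D mod 4 = 0")
  case True
  then obtain d where d: "D = 4 * d" by auto
  define j where "j = 1 + 2 * n * int d - 2 * m - 4 * n * int d - 2 * k"
  have "odd j" by (simp add: j_def)
  then have "\<bar>j\<bar> \<ge> 1" by (cases "j = 0") auto
  then have "\<bar>real_of_int j\<bar> \<ge> 1" by simp
  then have "1 \<le> (real_of_int j)\<^sup>2" by (metis abs_le_square_iff abs_1 one_power2)
  then have "1 * (sqrt D / 4)\<^sup>2 \<le> (real_of_int j)\<^sup>2 * (sqrt D / 4)\<^sup>2"
    by (intro mult_right_mono) auto
  also have "\<dots> = (p * (sqrt D / 4) + q / 2 - t)\<^sup>2"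
  proof -
    have "p * (sqrt D / 4) + q / 2 - t = of_int j * (sqrt D / 4)"
      unfolding p q k j_def d by (simp add: algebra_simps add_divide_distrib diff_divide_distrib)
    then show ?thesis by (simp only: power_mult_distrib)
  qed
  finally show ?thesis using True by (simp add: ghost_height_def)
next
  case False
  then have "D mod 4 = 3" using D by simp
  then have d: "D = 4 * (D div 4) + 3" by presburger
  define d where "d = D div 4"
  have D': "real D = 4 * real d + 3" using d by (simp add: d_def)
  define s where "s = sqrt D"
  have s: "s > 0" "s * s = D" using d by (simp_all add: s_def)
  define j where "j = n * (int d + 1) + m + k"
  have e: "p * ((real D - 1) / (4 * s)) + q / 2 - t = ((real D - 1) - 2 * real D * of_int j) / (4 * s)"
  proof -
    have "(p * ((real D - 1) / (4 * s)) + q / 2 - t) * (4 * s)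
      = p * (real D - 1) + 2 * q * s - 4 * t * s"
      using s(1) by (simp add: field_simps)
    also have "\<dots> = (1 + of_int n * real D / 2) * (real D - 1)
        - 2 * (s * s) * (of_int m + of_int n * real D / 2) - 2 * of_int k * (s * s)"
      unfolding p q k s_def[symmetric] by (simp add: algebra_simps)
    also have "\<dots> = (real D - 1) - 2 * real D * of_int j"
      unfolding s(2) j_def D' by (simp add: algebra_simps)
    finally show ?thesis using s(1) by (intro eq_divide_imp) auto
  qed
  have "real D - 1 \<le> \<bar>(real D - 1) - 2 * real D * of_int j\<bar>"
  proof (cases "j \<le> 0")
    case True
    then have "real D * of_int j \<le> 0" by (simp add: mult_nonneg_nonpos)
    then show ?thesis by linarith
  next
    case False
    then have "real D * 1 \<le> real D * of_int j" by (intro mult_left_mono) auto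
    then show ?thesis by linarith
  qed
  then have "((real D - 1) / (4 * s))\<^sup>2 \<le> (((real D - 1) - 2 * real D * of_int j) / (4 * s))\<^sup>2"
    using s(1) D' by (simp add: abs_le_square_iff[symmetric] divide_right_mono)
  then show ?thesis unfolding e[symmetric] using False by (simp add: ghost_height_def s_def)
qed

text \<open>A common point would give h^2 \<le> X^2 \<le> h^2 - 3/4 for the ghost height h and the
  scaled inversive product X.\<close>

theorem ghost_circle_disjoint:
  assumes D: "D mod 4 = 0 \<or> D mod 4 = 3" "D > 14"
    and w: "Some w \<in> SL2_orbit_reals (quad_order D)"
  shows "dist (ghost_center D) w \<noteq> ghost_radius D"
proof
  assume "dist (ghost_center D) w = ghost_radius D"
  then have "(cmod (w - ghost_center D))\<^sup>2 = (ghost_radius D)\<^sup>2"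
    by (simp add: dist_norm norm_minus_commute)
  \<comment> \<open>\<open>sqrt\<close> of a negative number is negative in HOL, so a radius that
    equals a distance already has a non-negative radicand.\<close>
  moreover have "(ghost_height D)\<^sup>2 - 3 / 4 \<ge> 0" if "ghost_radius D \<ge> 0"
    using that by (simp add: ghost_radius_def)
  moreover have "ghost_radius D \<ge> 0"
    using \<open>dist _ _ = _\<close> by (metis zero_le_dist)
  ultimately have circ: "(Re w - 1 / 2)\<^sup>2 + (Im w - ghost_height D)\<^sup>2 = (ghost_height D)\<^sup>2 - 3 / 4"
    unfolding cmod_power2 by (simp add: ghost_radius_def ghost_center_def)
  obtain a c p q m n k where *: "p = 1 + of_int n * real D / 2"
    "q = - (sqrt D * (of_int m + of_int n * real D / 2))" "a + c = of_int k * sqrt D / 2"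
    "p\<^sup>2 + q\<^sup>2 = 1 + 4 * a * c" "p * Im w + q * Re w = a * ((Re w)\<^sup>2 + (Im w)\<^sup>2) + c"
    using schmidt_circle_coefficients[OF D(1) w] by metis
  show False
    using inversive_product_le[OF *(4,5) circ] ghost_height_le[OF D(1) *(1,2,3)] by simp
qed

text \<open>The point is the limit of the orbit points constructed next, and strict containment lets
  the disc capture some of them. For even \<open>D\<close> it is the centre itself.\<close>

lemma ghost_radius_gt:
  assumes D: "D mod 4 = 0 \<or> D mod 4 = 3" "D > 14"
  shows "dist (ghost_center D) (Complex (1 / 2) (sqrt D / 4)) < ghost_radius D"
proof -
  define s where "s = sqrt D"
  have s: "s > 0" "s * s = D" using D(2) by (simp_all add: s_def)
  have "real D > 14" using D(2) by simp
  have "(s / 4 - ghost_height D)\<^sup>2 < (ghost_height D)\<^sup>2 - 3 / 4"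
  proof (cases "D mod 4 = 0")
    case True
    have "(s / 4)\<^sup>2 = D / 16" using s by (simp add: power2_eq_square)
    then show ?thesis using True D(2) by (simp add: ghost_height_def flip: s_def)
  next
    case False
    have "(ghost_height D)\<^sup>2 - (s / 4 - ghost_height D)\<^sup>2 = (s * ghost_height D) / 2 - s * s / 16"
      by (simp add: power2_eq_square algebra_simps)
    also have "s * ghost_height D = (real D - 1) / 4"
      using False s by (simp add: ghost_height_def flip: s_def)
    \<comment> \<open>The left-hand side is (D - 2) / 16, which exceeds 3/4 exactly when D >
      14.\<close>
    also have "(real D - 1) / 4 / 2 - s * s / 16 > 3 / 4"
      unfolding s(2) using \<open>real D > 14\<close> by (simp add: field_simps)
    finally show ?thesis by simp
  qed
  moreover have "dist (ghost_center D) (Complex (1 / 2) (sqrt D / 4)) = \<bar>s / 4 - ghost_height D\<bar>"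
    by (simp add: dist_norm ghost_center_def complex_diff complex_norm abs_minus_commute flip: s_def)
  ultimately show ?thesis
    unfolding ghost_radius_def by (metis real_sqrt_abs real_sqrt_less_mono)
qed

text \<open>The points \<open>t x\<^sup>2 / (1 + 4 t x)\<close> with \<open>x = 2 + \<surd>-D\<close> are images of \<open>\<infinity>\<close>, because
  \<open>(1 + 4 t x) (1 - 4 t x) + 16 t (t x\<^sup>2) = 1\<close>, and they tend to \<open>x / 4\<close>.\<close>

lemma orbit_point_near:
  assumes D: "D mod 4 = 0 \<or> D mod 4 = 3" and "e > 0"
  obtains w where "Some w \<in> SL2_orbit_reals (quad_order D)" "dist (Complex (1 / 2) (sqrt D / 4)) w < e"
proof -
  obtain t :: nat where t: "1 / e < real t" using reals_Archimedean2 by blast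
  have t0: "real t > 0" using t assms(2) by (meson less_trans zero_less_divide_1_iff)
  define T :: complex where "T = of_nat t"
  define x where "x = Complex 2 (sqrt D)"
  define \<beta> where "\<beta> = 1 + 4 * T * x"
  have TO: "T \<in> quad_order D" using of_int_in_quad_order[of "int t" D] by (simp add: T_def)
  have num: "numeral i \<in> quad_order D" for i
    using of_int_in_quad_order[of "numeral i" D] by simp
  have one: "1 \<in> quad_order D" using of_int_in_quad_order[of 1 D] by simp
  have xO: "x \<in> quad_order D"
    by (rule quad_orderI[of _ "2 - int D" 2]) (simp add: x_def quad_gen_def complex_eq_iff)
  have \<beta>O: "\<beta> \<in> quad_order D"
    unfolding \<beta>_def by (intro quad_order_add quad_order_mult[OF D] one num TO xO)
  have SL: "mat2 (T * x\<^sup>2) (\<beta> - 2) \<beta> (16 * T) \<in> SL2 (quad_order D)"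
    unfolding mat2_in_SL2_iff
  proof (intro conjI)
    show "T * x\<^sup>2 \<in> quad_order D"
      unfolding power2_eq_square by (intro quad_order_mult[OF D] TO xO)
    show "16 * T \<in> quad_order D" by (intro quad_order_mult[OF D] TO num)
    show "T * x\<^sup>2 * (16 * T) - (\<beta> - 2) * \<beta> = 1"
      by (simp add: \<beta>_def power2_eq_square algebra_simps)
  qed (use \<beta>O quad_order_diff[OF \<beta>O num] in auto)
  have "Re \<beta> = 1 + 8 * real t" by (simp add: \<beta>_def x_def T_def)
  then have \<beta>0: "\<beta> \<noteq> 0" using t0 by auto
  define w where "w = T * x\<^sup>2 / \<beta>"
  have "mobius (mat2 (T * x\<^sup>2) (\<beta> - 2) \<beta> (16 * T)) None = Some w"
    using \<beta>0 by (simp add: w_def)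
  then have wS: "Some w \<in> SL2_orbit_reals (quad_order D)"
    using SL unfolding SL2_orbit_reals_def extended_reals_def by (metis UN_I imageI insertI1)
  have xn: "cmod x \<ge> 2"
    using abs_Re_le_cmod[of x] by (simp add: x_def)
  have "4 * real t * cmod x = cmod (\<beta> - 1)" by (simp add: \<beta>_def T_def norm_mult)
  also have "\<dots> \<le> cmod \<beta> + 1" using norm_triangle_ineq4[of \<beta> 1] by simp
  finally have b1: "4 * real t * cmod x \<le> cmod \<beta> + 1" .
  have "1 * 1 \<le> real t * cmod x" using t0 xn by (intro mult_mono) auto
  then have b2: "real t * cmod x \<le> cmod \<beta>" using b1 by linarith
  \<comment> \<open>Because x \<beta> - 4 T x^2 = x. As |\<beta>| is at least t |x|, the distance is
    below 1 / t.\<close>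
  have "x / 4 - w = x / (4 * \<beta>)"
    using \<beta>0 by (simp add: w_def field_simps) (simp add: \<beta>_def power2_eq_square algebra_simps)
  then have "cmod (x / 4 - w) = cmod x / (4 * cmod \<beta>)" by (simp add: norm_divide norm_mult)
  also have "\<dots> < cmod x / (real t * cmod x)"
  proof (rule divide_strict_left_mono)
    have "cmod \<beta> > 0" using \<beta>0 by simp
    then show "real t * cmod x < 4 * cmod \<beta>" "0 < 4 * cmod \<beta> * (real t * cmod x)"
      using b2 t0 xn by (linarith, intro mult_pos_pos) auto
  qed (use xn in auto)
  also have "\<dots> = 1 / real t" using xn by (cases "x = 0") (simp_all add: field_simps)
  also have "\<dots> < e" using t t0 assms(2) by (simp add: field_simps)
  finally have "cmod (x / 4 - w) < e" .
  moreover have "x / 4 = Complex (1 / 2) (sqrt D / 4)" by (simp add: x_def complex_eq_iff)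
  ultimately show thesis using that[OF wS] by (simp add: dist_norm)
qed

text \<open>Without the circle the sphere falls into two open pieces, the disc and an exterior that
  includes infinity; \<open>u\<close> decides which of them holds \<open>T\<close>.\<close>

lemma connectedin_riemann_sphere_ball:
  assumes T: "connectedin riemann_sphere T" and "Some u \<in> T" "dist c u < r"
    and disj: "\<And>w. Some w \<in> T \<Longrightarrow> dist c w \<noteq> r"
  shows "T \<subseteq> Some ` ball c r"
proof -
  define U where "U = Some ` ball c r"
  define V where "V = insert None (Some ` (- cball c r))"
  have "openin riemann_sphere U"
    by (simp add: U_def openin_riemann_sphere_finite)
  moreover have "openin riemann_sphere V"
    unfolding V_def by (intro openin_riemann_sphere_infinity compact_cball)
  moreover have "T \<subseteq> U \<union> V"
  proof
    fix z assume z: "z \<in> T"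
    show "z \<in> U \<union> V"
    proof (cases z)
      case (Some w)
      then show ?thesis using disj[of w] z by (force simp: U_def V_def)
    qed (simp add: V_def)
  qed
  moreover have "U \<inter> V \<inter> T = {}" by (auto simp: U_def V_def)
  moreover have "Some u \<in> U" unfolding U_def using assms(3) by (intro imageI) simp
  then have "U \<inter> T \<noteq> {}" using assms(2) by blast
  ultimately have "V \<inter> T = {}" using T unfolding connectedin by metis
  then show ?thesis using \<open>T \<subseteq> U \<union> V\<close> unfolding U_def by blast
qed

theorem infinite_components_quad_order:
  assumes D: "D mod 4 = 0 \<or> D mod 4 = 3" "D > 14"
  shows "infinite (connected_components_of
           (subtopology riemann_sphere (SL2_orbit_reals (quad_order D))))"
proof -
  define S where "S = SL2_orbit_reals (quad_order D)"
  define Y where "Y = subtopology riemann_sphere S"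
  define c where "c = ghost_center D"
  define r where "r = ghost_radius D"
  define x where "x = Complex (1 / 2) (sqrt D / 4)"
  have cx: "dist c x < r" using ghost_radius_gt[OF D] by (simp add: c_def r_def x_def)
  then have "r - dist c x > 0" by simp
  then obtain w where w: "Some w \<in> S" "dist x w < r - dist c x"
    using orbit_point_near[OF D(1)] unfolding x_def S_def by metis
  have cw: "dist c w < r" using w(2) dist_triangle[of c w x] by linarith
  \<comment> \<open>A step longer than the diameter keeps the translated discs disjoint.\<close>
  obtain N :: nat where N: "2 * r < real N" using reals_Archimedean2 by blast
  define p where "p = (\<lambda>n::nat. w + of_nat (N * n))"
  have trans: "Some (z + of_int k) \<in> S" if "Some z \<in> S" for z k
    using SL2_orbit_reals_translate[OF D(1) of_int_in_quad_order] that by (simp add: S_def)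
  have pS: "Some (p n) \<in> S" for n
    using trans[OF w(1), of "int (N * n)"] by (simp add: p_def)
  have topY: "topspace Y = S"
    by (simp add: Y_def)
  have far: "\<not> dist (c + of_nat (N * m)) (p n) < r" if "m \<noteq> n" for m n
  proof
    assume "dist (c + of_nat (N * m)) (p n) < r"
    then have "cmod ((of_nat (N * m) - of_nat (N * n)) + (c - w)) < r"
      by (simp add: dist_norm p_def algebra_simps)
    moreover have "cmod (c - w) < r" using cw by (simp add: dist_norm)
    ultimately have "cmod (of_nat (N * m) - of_nat (N * n)) < 2 * r"
      using norm_triangle_ineq4[of "(of_nat (N * m) - of_nat (N * n)) + (c - w)" "c - w"] by simp
    moreover have "(of_nat (N * m) - of_nat (N * n) :: complex) = of_real (real N * (real m - real n))"
      by (simp add: algebra_simps)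
    ultimately have "real N * \<bar>real m - real n\<bar> < 2 * r"
      by (simp only: norm_of_real abs_mult abs_of_nat)
    moreover have "real N * 1 \<le> real N * \<bar>real m - real n\<bar>"
      using that by (intro mult_left_mono) auto
    ultimately show False using N by linarith
  qed
  have sep: "m = n" if conn: "connected_component_of Y (Some (p m)) (Some (p n))" for m n
  proof -
    obtain T where T: "connectedin riemann_sphere T" "T \<subseteq> S" "Some (p m) \<in> T" "Some (p n) \<in> T"
      using conn unfolding connected_component_of_def Y_def connectedin_subtopology by blast
    have "T \<subseteq> Some ` ball (c + of_nat (N * m)) r"
    proof (rule connectedin_riemann_sphere_ball[OF T(1,3)])
      show "dist (c + of_nat (N * m)) (p m) < r" using cw by (simp add: p_def)
      fix z assume "Some z \<in> T"
      \<comment> \<open>Integer translations preserve the arrangement, so avoiding the ghost circle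
        entails avoiding all of its integer translates.\<close>
      then have "Some (z + of_int (- int (N * m))) \<in> S" using T(2) trans by blast
      then have "dist c (z + of_int (- int (N * m))) \<noteq> r"
        using ghost_circle_disjoint[OF D] unfolding S_def c_def r_def by blast
      then show "dist (c + of_nat (N * m)) z \<noteq> r" by (simp add: dist_norm algebra_simps)
    qed
    then have "dist (c + of_nat (N * m)) (p n) < r" using T(4) by auto
    then show ?thesis using far by blast
  qed
  have "inj (\<lambda>n. connected_component_of_set Y (Some (p n)))"
  proof (rule injI)
    fix m n assume "connected_component_of_set Y (Some (p m)) = connected_component_of_set Y (Some (p n))"
    moreover have "Some (p n) \<in> connected_component_of_set Y (Some (p n))"
      using pS topY by (simp add: connected_component_of_refl)
    ultimately show "m = n" using sep by auto
  qed
  then have "infinite (range (\<lambda>n. connected_component_of_set Y (Some (p n))))"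
    by (rule range_inj_infinite)
  moreover have "range (\<lambda>n. connected_component_of_set Y (Some (p n))) \<subseteq> connected_components_of Y"
    using pS topY by (auto simp: connected_components_of_def)
  ultimately show ?thesis unfolding Y_def S_def by (rule infinite_super[rotated])
qed

theorem theorem7p1:
  fixes K :: "complex set"
  assumes "imaginary_quadratic_field K"
  shows "(connectedin riemann_sphere (schmidt_arrangement K) \<longleftrightarrow>
            is_euclidean_domain (ring_of_integers K)) \<and>
         (\<not> connectedin riemann_sphere (schmidt_arrangement K) \<longrightarrow>
            infinite (connected_components_of
              (subtopology riemann_sphere (schmidt_arrangement K))))"
proof -
  obtain D where D: "D mod 4 = 0 \<or> D mod 4 = 3" "D > 0" "D \<noteq> 12"
    and O: "ring_of_integers K = quad_order D"
    using imaginary_quadratic_ring_of_integers[OF assms] .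
  show ?thesis
  proof (cases "D < 12")
    case True
    then show ?thesis
      unfolding schmidt_arrangement_eq O
      using connected_SL2_orbit_quad_order[OF D(1,2)] euclidean_quad_order[OF D(1,2)] by simp
  next
    case False
    \<comment> \<open>Of 12, 13 and 14 only 12 is 0 or 3 modulo 4, and it is excluded.\<close>
    then have D14: "D > 14" using D(1,3) by presburger
    let ?Y = "subtopology riemann_sphere (SL2_orbit_reals (quad_order D))"
    have inf: "infinite (connected_components_of ?Y)"
      by (rule infinite_components_quad_order[OF D(1) D14])
    have "\<not> connectedin riemann_sphere (SL2_orbit_reals (quad_order D))"
    proof
      assume "connectedin riemann_sphere (SL2_orbit_reals (quad_order D))"
      then have "connected_components_of ?Y \<subseteq> {topspace ?Y}"
        by (simp add: connectedin_def connected_components_of_subset_sing)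
      then show False using inf finite_subset by blast
    qed
    then show ?thesis
      unfolding schmidt_arrangement_eq O using inf not_euclidean_quad_order[OF D14] by simp
  qed
qed

end
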